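(* Let $\mathbb{A}=\langle A;\wedge,\vee,\neg,0,1,\Diamond\rangle$ be a modal algebra. The following are equivalent: (1) the profinite completion $(\mu,\hat{\mathbb{A}})$ is (isomorphic, as a completion, to) the MacNeille completion of $\mathbb{A}$, and $\Diamond$ is smooth; (2) $\mathbb{A}$ is residually finite and for every $\theta\in\Phi_{\mathbb{A}}$, the congruence class $1/\theta$ is a principal lattice filter of $\mathbb{A}$ (i.e. $1/\theta = \{b\in A\mid b\ge a\}$ for some $a\in A$).
   Context: A modal algebra is a Boolean algebra with a unary operation $\Diamond$ satisfying $\Diamond 0=0$ and $\Diamond(a\vee b)=\Diamond a\vee\Diamond b$. $\Phi_{\mathbb{A}}$ denotes the set of (modal algebra) congruences $\theta$ of $\mathbb{A}$ with $\mathbb{A}/\theta$ finite; $\mathbb{A}$ is residually finite if for all $a\ne b$ in $A$ there is $\theta\in\Phi_{\mathbb{A}}$ with $a/\theta\ne b/\theta$. The profinite completion is $\hat{\mathbb{A}}=\{\alpha\in\prod_{\theta\in\Phi_{\mathbb{A}}}\mathbb{A}/\theta\mid$ for all $\theta\subseteq\psi$ in $\Phi_{\mathbb{A}}$, if $\alpha(\theta)=a/\theta$ then $\alpha(\psi)=a/\psi\}$ with coordinatewise operations, and $\mu\colon\mathbb{A}\to\hat{\mathbb{A}}$, $\mu(a)=(a/\theta)_{\theta\in\Phi_{\mathbb{A}}}$. A completion of a lattice $\mathbb{B}$ is a pair $(m,\mathbb{C})$ with $m\colon\mathbb{B}\hookrightarrow\mathbb{C}$ a lattice embedding into a complete lattice;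 two completions $(m,\mathbb{C}),(k,\mathbb{D})$ are isomorphic if $g m=k$ for some lattice isomorphism $g\colon\mathbb{C}\to\mathbb{D}$. The MacNeille completion $\bar{\mathbb{B}}$ of a Boolean algebra $\mathbb{B}$ is (up to isomorphism) the completion $(m,\mathbb{C})$ with $m[B]$ join-dense in $\mathbb{C}$ (every element of $C$ is the join of the elements of $m[B]$ below it). For an order-preserving map $f\colon\mathbb{B}\to\mathbb{B}$ of a Boolean algebra with MacNeille completion $(m,\bar{\mathbb{B}})$, the lower extension is $f^{\circ}\colon\bar{\mathbb{B}}\to\bar{\mathbb{B}}$, $f^\circ(x)=\bigvee\{m(f(a))\mid m(a)\le x\}$, and the upper extension is $f^{\bullet}(x)=\bigwedge\{m(f(a))\mid x\le m(a)\}$; $f$ is smooth if $f^\circ=f^\bullet$. *)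

theory Defs
  imports "HOL-Algebra.Complete_Lattice" "HOL-Library.FuncSet"
begin

text \<open>\<^theory>\<open>HOL-Algebra.Lattice\<close> hides the type class operations; the Boolean algebra
  is a type of class \<^class>\<open>boolean_algebra\<close>, so its operations are always the class ones.\<close>

hide_const (open) Lattice.inf Lattice.sup Order.top

section \<open>Modal algebras and finite quotients\<close>

locale modal_algebra =
  fixes dia :: "'a::boolean_algebra \<Rightarrow> 'a"
  assumes dia_bot: "dia bot = bot"
    and dia_sup: "dia (sup a b) = sup (dia a) (dia b)"

definition modal_congruence :: "('a::boolean_algebra \<Rightarrow> 'a) \<Rightarrow> ('a \<times> 'a) set \<Rightarrow> bool" where
  "modal_congruence dia \<theta> \<longleftrightarrow> equiv UNIV \<theta> \<and>
     (\<forall>a a' b b'. (a, a') \<in> \<theta> \<longrightarrow> (b, b') \<in> \<theta> \<longrightarrow> (inf a b, inf a' b') \<in> \<theta>) \<and>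
     (\<forall>a a' b b'. (a, a') \<in> \<theta> \<longrightarrow> (b, b') \<in> \<theta> \<longrightarrow> (sup a b, sup a' b') \<in> \<theta>) \<and>
     (\<forall>a a'. (a, a') \<in> \<theta> \<longrightarrow> (- a, - a') \<in> \<theta>) \<and>
     (\<forall>a a'. (a, a') \<in> \<theta> \<longrightarrow> (dia a, dia a') \<in> \<theta>)"

definition fin_congs :: "('a::boolean_algebra \<Rightarrow> 'a) \<Rightarrow> ('a \<times> 'a) set set" where
  "fin_congs dia = {\<theta>. modal_congruence dia \<theta> \<and> finite (UNIV // \<theta>)}"

definition residually_finite :: "('a::boolean_algebra \<Rightarrow> 'a) \<Rightarrow> bool" where
  "residually_finite dia \<longleftrightarrow> (\<forall>a b. a \<noteq> b \<longrightarrow> (\<exists>\<theta>\<in>fin_congs dia. \<theta> `` {a} \<noteq> \<theta> `` {b}))"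

section \<open>The profinite completion\<close>

text \<open>For a congruence \<open>\<theta>\<close> and congruence classes \<open>X = a/\<theta>\<close>, \<open>Y = b/\<theta>\<close> this is \<open>(f a b)/\<theta>\<close>.\<close>

definition quot_op :: "('a \<Rightarrow> 'a \<Rightarrow> 'a) \<Rightarrow> ('a \<times> 'a) set \<Rightarrow> 'a set \<Rightarrow> 'a set \<Rightarrow> 'a set" where
  "quot_op f \<theta> X Y = (\<Union>a\<in>X. \<Union>b\<in>Y. \<theta> `` {f a b})"

definition prof_carrier ::
    "('a::boolean_algebra \<Rightarrow> 'a) \<Rightarrow> (('a \<times> 'a) set \<Rightarrow> 'a set) set" where
  "prof_carrier dia = {\<alpha> \<in> (\<Pi>\<^sub>E \<theta>\<in>fin_congs dia. UNIV // \<theta>).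
     \<forall>\<theta>\<in>fin_congs dia. \<forall>\<psi>\<in>fin_congs dia. \<theta> \<subseteq> \<psi> \<longrightarrow>
       (\<forall>a. \<alpha> \<theta> = \<theta> `` {a} \<longrightarrow> \<alpha> \<psi> = \<psi> `` {a})}"

definition prof_op :: "('a::boolean_algebra \<Rightarrow> 'a) \<Rightarrow> ('a \<Rightarrow> 'a \<Rightarrow> 'a) \<Rightarrow>
    (('a \<times> 'a) set \<Rightarrow> 'a set) \<Rightarrow> (('a \<times> 'a) set \<Rightarrow> 'a set) \<Rightarrow> ('a \<times> 'a) set \<Rightarrow> 'a set" where
  "prof_op dia f \<alpha> \<beta> = (\<lambda>\<theta>\<in>fin_congs dia. quot_op f \<theta> (\<alpha> \<theta>) (\<beta> \<theta>))"

text \<open>The underlying lattice, given by the order of the coordinatewise meet. That its binary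
  meets and joins are the coordinatewise ones is shown below.\<close>

definition profinite_completion ::
    "('a::boolean_algebra \<Rightarrow> 'a) \<Rightarrow> (('a \<times> 'a) set \<Rightarrow> 'a set) gorder" where
  "profinite_completion dia =
     \<lparr>carrier = prof_carrier dia, eq = (=), le = (\<lambda>\<alpha> \<beta>. prof_op dia inf \<alpha> \<beta> = \<alpha>)\<rparr>"

definition prof_embed ::
    "('a::boolean_algebra \<Rightarrow> 'a) \<Rightarrow> 'a \<Rightarrow> ('a \<times> 'a) set \<Rightarrow> 'a set" where
  "prof_embed dia a = (\<lambda>\<theta>\<in>fin_congs dia. \<theta> `` {a})"

section \<open>Completions\<close>

definition completion :: "('a::lattice \<Rightarrow> 'c) \<Rightarrow> 'c gorder \<Rightarrow> bool" where
  "completion m C \<longleftrightarrow> complete_lattice C \<and> range m \<subseteq> carrier C \<and> inj m \<and>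
     (\<forall>a b. m (inf a b) = m a \<sqinter>\<^bsub>C\<^esub> m b) \<and> (\<forall>a b. m (sup a b) = m a \<squnion>\<^bsub>C\<^esub> m b)"

definition lattice_iso :: "('c \<Rightarrow> 'd) \<Rightarrow> 'c gorder \<Rightarrow> 'd gorder \<Rightarrow> bool" where
  "lattice_iso g C D \<longleftrightarrow> bij_betw g (carrier C) (carrier D) \<and>
     (\<forall>x\<in>carrier C. \<forall>y\<in>carrier C. g (x \<sqinter>\<^bsub>C\<^esub> y) = g x \<sqinter>\<^bsub>D\<^esub> g y \<and> g (x \<squnion>\<^bsub>C\<^esub> y) = g x \<squnion>\<^bsub>D\<^esub> g y)"

definition completion_iso ::
    "('a::lattice \<Rightarrow> 'c) \<Rightarrow> 'c gorder \<Rightarrow> ('a \<Rightarrow> 'd) \<Rightarrow> 'd gorder \<Rightarrow> bool" where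
  "completion_iso m C k D \<longleftrightarrow> completion m C \<and> completion k D \<and>
     (\<exists>g. lattice_iso g C D \<and> g \<circ> m = k)"

text \<open>Meet-density follows from join-density for Boolean embeddings into Boolean lattices, by
  taking complements. It has to be demanded here because completions are arbitrary complete
  lattices: without it the lattice of ideals would qualify, and uniqueness up to isomorphism
  would fail.\<close>

definition macneille_completion :: "('a::boolean_algebra \<Rightarrow> 'c) \<Rightarrow> 'c gorder \<Rightarrow> bool" where
  "macneille_completion m C \<longleftrightarrow> completion m C \<and>
     (\<forall>x\<in>carrier C. x = \<Squnion>\<^bsub>C\<^esub> {m a |a. m a \<sqsubseteq>\<^bsub>C\<^esub> x}) \<and>
     (\<forall>x\<in>carrier C. x = \<Sqinter>\<^bsub>C\<^esub> {m a |a. x \<sqsubseteq>\<^bsub>C\<^esub> m a})"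

definition lower_ext :: "('a \<Rightarrow> 'c) \<Rightarrow> 'c gorder \<Rightarrow> ('a \<Rightarrow> 'a) \<Rightarrow> 'c \<Rightarrow> 'c" where
  "lower_ext m C f x = \<Squnion>\<^bsub>C\<^esub> {m (f a) |a. m a \<sqsubseteq>\<^bsub>C\<^esub> x}"

definition upper_ext :: "('a \<Rightarrow> 'c) \<Rightarrow> 'c gorder \<Rightarrow> ('a \<Rightarrow> 'a) \<Rightarrow> 'c \<Rightarrow> 'c" where
  "upper_ext m C f x = \<Sqinter>\<^bsub>C\<^esub> {m (f a) |a. x \<sqsubseteq>\<^bsub>C\<^esub> m a}"

definition smooth :: "('a \<Rightarrow> 'c) \<Rightarrow> 'c gorder \<Rightarrow> ('a \<Rightarrow> 'a) \<Rightarrow> bool" where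
  "smooth m C f \<longleftrightarrow> (\<forall>x\<in>carrier C. lower_ext m C f x = upper_ext m C f x)"

section \<open>Existence and uniqueness of the MacNeille completion\<close>

lemma (in partial_order) sup_eqI: "least L s (Upper L A) \<Longrightarrow> \<Squnion>A = s"
  unfolding sup_def by (rule some_equality) (auto intro: least_unique)

lemma (in partial_order) inf_eqI: "greatest L s (Lower L A) \<Longrightarrow> \<Sqinter>A = s"
  unfolding inf_def by (rule some_equality) (auto intro: greatest_unique)

definition ubs :: "'a::order set \<Rightarrow> 'a set" where "ubs S = {u. \<forall>s\<in>S. s \<le> u}"
definition lbs :: "'a::order set \<Rightarrow> 'a set" where "lbs S = {l. \<forall>s\<in>S. l \<le> s}"

definition cuts :: "'a::order set gorder" where
  "cuts = \<lparr>carrier = {S. lbs (ubs S) = S}, eq = (=), le = (\<subseteq>)\<rparr>"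

lemma cuts_simps [simp]: "S \<in> carrier cuts \<longleftrightarrow> lbs (ubs S) = S" "S \<sqsubseteq>\<^bsub>cuts\<^esub> T \<longleftrightarrow> S \<subseteq> T"
  "S .=\<^bsub>cuts\<^esub> T \<longleftrightarrow> S = T"
  by (auto simp: cuts_def)

lemma cut_closed: "lbs (ubs (lbs (ubs S))) = lbs (ubs S)"
  by (auto simp: lbs_def ubs_def)

lemma cut_Iic: "lbs (ubs {..a}) = {..a}"
  by (auto simp: lbs_def ubs_def)

lemma cuts_partial_order: "partial_order cuts"
  by standard (auto simp: cuts_def)

lemma cuts_least:
  assumes "A \<subseteq> carrier cuts"
  shows "least cuts (lbs (ubs (\<Union>A))) (Upper cuts A)"
proof (rule least_UpperI)
  show "S \<sqsubseteq>\<^bsub>cuts\<^esub> lbs (ubs (\<Union>A))" if "S \<in> A" for S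
    using that by (auto simp: lbs_def ubs_def)
  show "lbs (ubs (\<Union>A)) \<sqsubseteq>\<^bsub>cuts\<^esub> T" if "T \<in> Upper cuts A" for T
  proof -
    have "lbs (ubs T) = T" using that by (auto simp: Upper_def)
    moreover have "\<Union>A \<subseteq> T" using that assms unfolding Upper_def by fastforce
    moreover from this have "lbs (ubs (\<Union>A)) \<subseteq> lbs (ubs T)"
      unfolding lbs_def ubs_def by blast
    ultimately show ?thesis by simp
  qed
qed (use assms cut_closed in auto)

lemma cuts_greatest:
  assumes "A \<subseteq> carrier cuts"
  shows "greatest cuts (\<Inter>A) (Lower cuts A)"
proof -
  have "lbs (ubs (\<Inter>A)) \<subseteq> S" if "S \<in> A" for S
  proof -
    have "lbs (ubs S) = S" using that assms by auto
    moreover have "ubs S \<subseteq> ubs (\<Inter>A)" using that by (auto simp: ubs_def)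
    ultimately show ?thesis by (auto simp: lbs_def)
  qed
  then have "lbs (ubs (\<Inter>A)) = \<Inter>A" by (auto simp: lbs_def ubs_def)
  then show ?thesis
    using assms by (auto simp: greatest_def Lower_def) (use cuts_simps(1) in blast)
qed

lemma cuts_complete_lattice: "complete_lattice cuts"
  by (rule partial_order.complete_latticeI[OF cuts_partial_order])
    (use cuts_least cuts_greatest in blast)+

theorem macneille_completion_cuts:
  "macneille_completion (\<lambda>a::'a::boolean_algebra. {..a}) cuts"
proof -
  interpret C: complete_lattice "cuts :: 'a set gorder" by (rule cuts_complete_lattice)
  have Sup: "\<Squnion>\<^bsub>cuts\<^esub> A = lbs (ubs (\<Union>A))" if "A \<subseteq> carrier cuts" for A :: "'a set set"
    using cuts_least[OF that] by (rule C.sup_eqI)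
  have Inf: "\<Sqinter>\<^bsub>cuts\<^esub> A = \<Inter>A" if "A \<subseteq> carrier cuts" for A :: "'a set set"
    using cuts_greatest[OF that] by (rule C.inf_eqI)
  have "{..inf a b} = {..a} \<sqinter>\<^bsub>cuts\<^esub> {..b}" for a b :: 'a
    unfolding meet_def by (subst Inf) (auto simp: cut_Iic)
  moreover have "{..sup a b} = {..a} \<squnion>\<^bsub>cuts\<^esub> {..b}" for a b :: 'a
  proof -
    have "ubs ({..a} \<union> {..b}) = {sup a b..}" by (auto simp: ubs_def)
    moreover have "lbs {sup a b..} = {..sup a b}"
      by (auto simp: lbs_def intro: order_trans)
    moreover have "{{..a}, {..b}} \<subseteq> carrier cuts" by (auto simp: cut_Iic)
    ultimately show ?thesis unfolding join_def by (simp add: Sup)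
  qed
  moreover have "S = \<Squnion>\<^bsub>cuts\<^esub> {{..a} |a. {..a} \<sqsubseteq>\<^bsub>cuts\<^esub> S}" if S: "S \<in> carrier cuts" for S :: "'a set"
  proof -
    have "{..a} \<subseteq> S" if "a \<in> S" for a
    proof -
      have "{..a} \<subseteq> lbs (ubs S)" using that by (fastforce simp: lbs_def ubs_def)
      then show ?thesis using S by simp
    qed
    then have "\<Union>{{..a} |a. {..a} \<subseteq> S} = S" by blast
    then show ?thesis using S by (subst Sup) (auto simp: cut_Iic)
  qed
  moreover have "S = \<Sqinter>\<^bsub>cuts\<^esub> {{..a} |a. S \<sqsubseteq>\<^bsub>cuts\<^esub> {..a}}" if S: "S \<in> carrier cuts" for S :: "'a set"
  proof -
    have "\<Inter>{{..a} |a. S \<subseteq> {..a}} = lbs (ubs S)" by (auto simp: lbs_def ubs_def)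
    then show ?thesis using S by (subst Inf) (auto simp: cut_Iic)
  qed
  ultimately show ?thesis
    unfolding macneille_completion_def completion_def
    using cuts_complete_lattice by (auto simp: cut_Iic inj_on_def)
qed

lemma completion_le_iff:
  assumes "completion m C"
  shows "m a \<sqsubseteq>\<^bsub>C\<^esub> m b \<longleftrightarrow> a \<le> b"
proof -
  interpret complete_lattice C using assms by (simp add: completion_def)
  have c: "m a \<in> carrier C" "m b \<in> carrier C" using assms by (auto simp: completion_def)
  have "m a \<sqsubseteq>\<^bsub>C\<^esub> m b \<longleftrightarrow> m a \<sqinter>\<^bsub>C\<^esub> m b = m a"
    using le_iff_join[OF c] by auto
  also have "\<dots> \<longleftrightarrow> m (inf a b) = m a" using assms by (simp add: completion_def)
  also have "\<dots> \<longleftrightarrow> inf a b = a" using assms by (metis completion_def inj_eq)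
  finally show ?thesis by (simp add: le_iff_inf)
qed

lemma macneille_transfer:
  assumes M: "macneille_completion m C" and K: "completion k D" and x: "x \<in> carrier C"
  shows "k b \<sqsubseteq>\<^bsub>D\<^esub> \<Squnion>\<^bsub>D\<^esub> {k a |a. m a \<sqsubseteq>\<^bsub>C\<^esub> x} \<longleftrightarrow> m b \<sqsubseteq>\<^bsub>C\<^esub> x"
proof
  have m: "completion m C" using M by (simp add: macneille_completion_def)
  interpret C: complete_lattice C using m by (simp add: completion_def)
  interpret D: complete_lattice D using K by (simp add: completion_def)
  have mc: "m a \<in> carrier C" for a using m by (auto simp: completion_def)
  have kc: "k a \<in> carrier D" for a using K by (auto simp: completion_def)
  let ?g = "\<Squnion>\<^bsub>D\<^esub> {k a |a. m a \<sqsubseteq>\<^bsub>C\<^esub> x}"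
  have gc: "?g \<in> carrier D" by (rule D.sup_closed) (auto simp: kc)
  show "k b \<sqsubseteq>\<^bsub>D\<^esub> ?g" if "m b \<sqsubseteq>\<^bsub>C\<^esub> x"
    by (rule D.sup_upper) (use that kc in auto)
  assume b: "k b \<sqsubseteq>\<^bsub>D\<^esub> ?g"
  have "m b \<sqsubseteq>\<^bsub>C\<^esub> \<Sqinter>\<^bsub>C\<^esub> {m c |c. x \<sqsubseteq>\<^bsub>C\<^esub> m c}"
  proof (rule C.inf_greatest)
    fix y assume "y \<in> {m c |c. x \<sqsubseteq>\<^bsub>C\<^esub> m c}"
    then obtain c where c: "y = m c" "x \<sqsubseteq>\<^bsub>C\<^esub> m c" by blast
    have "?g \<sqsubseteq>\<^bsub>D\<^esub> k c"
    proof (rule D.sup_least)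
      fix z assume "z \<in> {k a |a. m a \<sqsubseteq>\<^bsub>C\<^esub> x}"
      then obtain a where a: "z = k a" "m a \<sqsubseteq>\<^bsub>C\<^esub> x" by blast
      have "m a \<sqsubseteq>\<^bsub>C\<^esub> m c" using C.le_trans[OF a(2) c(2)] mc x by simp
      then show "z \<sqsubseteq>\<^bsub>D\<^esub> k c" by (simp add: a completion_le_iff[OF m] completion_le_iff[OF K])
    qed (auto simp: kc)
    then have "k b \<sqsubseteq>\<^bsub>D\<^esub> k c" using D.le_trans[OF b] kc gc by simp
    then show "m b \<sqsubseteq>\<^bsub>C\<^esub> y" by (simp add: c completion_le_iff[OF m] completion_le_iff[OF K])
  qed (auto simp: mc)
  then show "m b \<sqsubseteq>\<^bsub>C\<^esub> x" using M x by (simp add: macneille_completion_def)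
qed

lemma order_iso_lattice_iso:
  assumes "complete_lattice C" "complete_lattice D" and bij: "bij_betw g (carrier C) (carrier D)"
    and le: "\<And>x y. x \<in> carrier C \<Longrightarrow> y \<in> carrier C \<Longrightarrow> g x \<sqsubseteq>\<^bsub>D\<^esub> g y \<longleftrightarrow> x \<sqsubseteq>\<^bsub>C\<^esub> y"
  shows "lattice_iso g C D"
proof -
  interpret C: complete_lattice C by fact
  interpret D: complete_lattice D by fact
  have gc: "g x \<in> carrier D" if "x \<in> carrier C" for x using bij that by (auto simp: bij_betw_def)
  have ex: "\<exists>x\<in>carrier C. z = g x" if "z \<in> carrier D" for z
    using bij that by (auto simp: bij_betw_def)
  have "g (x \<sqinter>\<^bsub>C\<^esub> y) = g x \<sqinter>\<^bsub>D\<^esub> g y \<and> g (x \<squnion>\<^bsub>C\<^esub> y) = g x \<squnion>\<^bsub>D\<^esub> g y"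
    if xy: "x \<in> carrier C" "y \<in> carrier C" for x y
  proof
    have "is_glb D (g (x \<sqinter>\<^bsub>C\<^esub> y)) {g x, g y}"
    proof (rule greatest_LowerI)
      fix z assume "z \<in> Lower D {g x, g y}"
      then have z: "z \<in> carrier D" "z \<sqsubseteq>\<^bsub>D\<^esub> g x" "z \<sqsubseteq>\<^bsub>D\<^esub> g y" using gc xy by (auto simp: Lower_def)
      with ex obtain w where w: "w \<in> carrier C" "z = g w" by blast
      with z le xy have "w \<sqsubseteq>\<^bsub>C\<^esub> x \<sqinter>\<^bsub>C\<^esub> y" by (auto intro: C.meet_le)
      then show "z \<sqsubseteq>\<^bsub>D\<^esub> g (x \<sqinter>\<^bsub>C\<^esub> y)" using le w xy by simp
    qed (use gc xy le C.meet_left C.meet_right in auto)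
    then show "g (x \<sqinter>\<^bsub>C\<^esub> y) = g x \<sqinter>\<^bsub>D\<^esub> g y" unfolding meet_def by (simp add: D.inf_eqI)
    have "is_lub D (g (x \<squnion>\<^bsub>C\<^esub> y)) {g x, g y}"
    proof (rule least_UpperI)
      fix z assume "z \<in> Upper D {g x, g y}"
      then have z: "z \<in> carrier D" "g x \<sqsubseteq>\<^bsub>D\<^esub> z" "g y \<sqsubseteq>\<^bsub>D\<^esub> z" using gc xy by (auto simp: Upper_def)
      with ex obtain w where w: "w \<in> carrier C" "z = g w" by blast
      with z le xy have "x \<squnion>\<^bsub>C\<^esub> y \<sqsubseteq>\<^bsub>C\<^esub> w" by (auto intro: C.join_le)
      then show "g (x \<squnion>\<^bsub>C\<^esub> y) \<sqsubseteq>\<^bsub>D\<^esub> z" using le w xy by simp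
    qed (use gc xy le C.join_left C.join_right in auto)
    then show "g (x \<squnion>\<^bsub>C\<^esub> y) = g x \<squnion>\<^bsub>D\<^esub> g y" unfolding join_def by (simp add: D.sup_eqI)
  qed
  then show ?thesis using bij by (simp add: lattice_iso_def)
qed

theorem macneille_completion_unique:
  assumes M: "macneille_completion m C" and K: "macneille_completion k D"
  shows "completion_iso m C k D"
proof -
  have m: "completion m C" and k: "completion k D"
    using M K by (auto simp: macneille_completion_def)
  interpret C: complete_lattice C using m by (simp add: completion_def)
  interpret D: complete_lattice D using k by (simp add: completion_def)
  have mc: "m a \<in> carrier C" for a using m by (auto simp: completion_def)
  have kc: "k a \<in> carrier D" for a using k by (auto simp: completion_def)
  define g where "g x = \<Squnion>\<^bsub>D\<^esub> {k a |a. m a \<sqsubseteq>\<^bsub>C\<^esub> x}" for x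
  define h where "h y = \<Squnion>\<^bsub>C\<^esub> {m a |a. k a \<sqsubseteq>\<^bsub>D\<^esub> y}" for y
  have gc: "g x \<in> carrier D" for x unfolding g_def by (rule D.sup_closed) (auto simp: kc)
  have hc: "h y \<in> carrier C" for y unfolding h_def by (rule C.sup_closed) (auto simp: mc)
  have kg: "k b \<sqsubseteq>\<^bsub>D\<^esub> g x \<longleftrightarrow> m b \<sqsubseteq>\<^bsub>C\<^esub> x" if "x \<in> carrier C" for b x
    unfolding g_def by (rule macneille_transfer[OF M k that])
  have mh: "m b \<sqsubseteq>\<^bsub>C\<^esub> h y \<longleftrightarrow> k b \<sqsubseteq>\<^bsub>D\<^esub> y" if "y \<in> carrier D" for b y
    unfolding h_def by (rule macneille_transfer[OF K m that])
  have hg: "h (g x) = x" if "x \<in> carrier C" for x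
    using M that by (simp add: h_def kg macneille_completion_def)
  have gh: "g (h y) = y" if "y \<in> carrier D" for y
    using K that by (simp add: g_def mh macneille_completion_def)
  have gmono: "g x \<sqsubseteq>\<^bsub>D\<^esub> g y" if "x \<in> carrier C" "y \<in> carrier C" "x \<sqsubseteq>\<^bsub>C\<^esub> y" for x y
    unfolding g_def[of x]
  proof (rule D.sup_least)
    fix z assume "z \<in> {k a |a. m a \<sqsubseteq>\<^bsub>C\<^esub> x}"
    then obtain a where "z = k a" "m a \<sqsubseteq>\<^bsub>C\<^esub> x" by blast
    then show "z \<sqsubseteq>\<^bsub>D\<^esub> g y" using kg that C.le_trans[of "m a" x y] mc by simp
  qed (auto simp: kc gc)
  have hmono: "h x \<sqsubseteq>\<^bsub>C\<^esub> h y" if "x \<in> carrier D" "y \<in> carrier D" "x \<sqsubseteq>\<^bsub>D\<^esub> y" for x y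
    unfolding h_def[of x]
  proof (rule C.sup_least)
    fix z assume "z \<in> {m a |a. k a \<sqsubseteq>\<^bsub>D\<^esub> x}"
    then obtain a where "z = m a" "k a \<sqsubseteq>\<^bsub>D\<^esub> x" by blast
    then show "z \<sqsubseteq>\<^bsub>C\<^esub> h y" using mh that D.le_trans[of "k a" x y] kc by simp
  qed (auto simp: mc hc)
  have "bij_betw g (carrier C) (carrier D)"
    by (rule bij_betw_byWitness[where f' = h]) (use gc hc gh hg in auto)
  moreover have "g x \<sqsubseteq>\<^bsub>D\<^esub> g y \<longleftrightarrow> x \<sqsubseteq>\<^bsub>C\<^esub> y" if "x \<in> carrier C" "y \<in> carrier C" for x y
    using gmono hmono[OF gc gc] hg that by metis
  ultimately have "lattice_iso g C D"
    by (intro order_iso_lattice_iso C.complete_lattice_axioms D.complete_lattice_axioms)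
  moreover have "g (m a) = k a" for a
  proof -
    have "k a = \<Squnion>\<^bsub>D\<^esub> {k b |b. k b \<sqsubseteq>\<^bsub>D\<^esub> k a}"
      using K kc by (simp add: macneille_completion_def)
    then show ?thesis
      by (simp add: g_def completion_le_iff[OF m] completion_le_iff[OF k])
  qed
  ultimately show ?thesis
    unfolding completion_iso_def using m k by (auto simp: fun_eq_iff)
qed

section \<open>The lattice operations of the profinite completion\<close>

lemma fin_congs_equiv: "\<theta> \<in> fin_congs dia \<Longrightarrow> equiv UNIV \<theta>"
  by (simp add: fin_congs_def modal_congruence_def)

lemma quot_op_class:
  assumes "equiv UNIV \<theta>"
    and "\<And>a a' b b'. (a, a') \<in> \<theta> \<Longrightarrow> (b, b') \<in> \<theta> \<Longrightarrow> (f a b, f a' b') \<in> \<theta>"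
  shows "quot_op f \<theta> (\<theta> `` {a}) (\<theta> `` {b}) = \<theta> `` {f a b}"
proof -
  have "\<theta> `` {f a' b'} = \<theta> `` {f a b}" if "a' \<in> \<theta> `` {a}" "b' \<in> \<theta> `` {b}" for a' b'
    using equiv_class_eq[OF assms(1) assms(2)[of a a' b b']] that by simp
  moreover have "a \<in> \<theta> `` {a}" "b \<in> \<theta> `` {b}" using equiv_class_self[OF assms(1)] by auto
  ultimately show ?thesis unfolding quot_op_def by blast
qed

lemma quot_inf_sup:
  assumes "\<theta> \<in> fin_congs dia"
  shows "quot_op inf \<theta> (\<theta> `` {a}) (\<theta> `` {b}) = \<theta> `` {inf a b}"
    and "quot_op sup \<theta> (\<theta> `` {a}) (\<theta> `` {b}) = \<theta> `` {sup a b}"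
  by (rule quot_op_class[OF fin_congs_equiv[OF assms]];
      use assms in \<open>simp add: fin_congs_def modal_congruence_def\<close>)+

lemma prof_class:
  assumes "\<alpha> \<in> prof_carrier dia" "\<theta> \<in> fin_congs dia"
  obtains a where "\<alpha> \<theta> = \<theta> `` {a}"
    and "\<And>\<psi>. \<psi> \<in> fin_congs dia \<Longrightarrow> \<theta> \<subseteq> \<psi> \<Longrightarrow> \<alpha> \<psi> = \<psi> `` {a}"
proof -
  have "\<alpha> \<theta> \<in> UNIV // \<theta>" using assms unfolding prof_carrier_def by (blast dest: PiE_mem)
  then obtain a where "\<alpha> \<theta> = \<theta> `` {a}" by (rule quotientE)
  moreover from this have "\<alpha> \<psi> = \<psi> `` {a}" if "\<psi> \<in> fin_congs dia" "\<theta> \<subseteq> \<psi>" for \<psi>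
    using assms that unfolding prof_carrier_def by blast
  ultimately show thesis by (rule that)
qed

lemma prof_op_closed:
  assumes "\<alpha> \<in> prof_carrier dia" "\<beta> \<in> prof_carrier dia"
    and f: "\<And>\<theta> a b. \<theta> \<in> fin_congs dia \<Longrightarrow> quot_op f \<theta> (\<theta> `` {a}) (\<theta> `` {b}) = \<theta> `` {f a b}"
  shows "prof_op dia f \<alpha> \<beta> \<in> prof_carrier dia"
proof -
  have *: "\<exists>c. \<forall>\<psi>\<in>fin_congs dia. \<theta> \<subseteq> \<psi> \<longrightarrow> prof_op dia f \<alpha> \<beta> \<psi> = \<psi> `` {c}"
    if t: "\<theta> \<in> fin_congs dia" for \<theta>
  proof -
    obtain a where a: "\<And>\<psi>. \<psi> \<in> fin_congs dia \<Longrightarrow> \<theta> \<subseteq> \<psi> \<Longrightarrow> \<alpha> \<psi> = \<psi> `` {a}"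
      using prof_class[OF assms(1) t] by metis
    obtain b where b: "\<And>\<psi>. \<psi> \<in> fin_congs dia \<Longrightarrow> \<theta> \<subseteq> \<psi> \<Longrightarrow> \<beta> \<psi> = \<psi> `` {b}"
      using prof_class[OF assms(2) t] by metis
    show ?thesis by (rule exI[of _ "f a b"]) (simp add: prof_op_def a b f)
  qed
  have "prof_op dia f \<alpha> \<beta> \<theta> \<in> UNIV // \<theta>" if "\<theta> \<in> fin_congs dia" for \<theta>
    using *[OF that] that quotientI[OF UNIV_I] by (metis order_refl)
  moreover have "prof_op dia f \<alpha> \<beta> \<psi> = \<psi> `` {a}"
    if t: "\<theta> \<in> fin_congs dia" "\<psi> \<in> fin_congs dia" "\<theta> \<subseteq> \<psi>"
      and a: "prof_op dia f \<alpha> \<beta> \<theta> = \<theta> `` {a}" for \<theta> \<psi> a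
  proof -
    obtain c where c: "\<And>\<psi>. \<psi> \<in> fin_congs dia \<Longrightarrow> \<theta> \<subseteq> \<psi> \<Longrightarrow> prof_op dia f \<alpha> \<beta> \<psi> = \<psi> `` {c}"
      using *[OF t(1)] by metis
    have "\<theta> `` {a} = \<theta> `` {c}" using a c[OF t(1)] by simp
    then have "(a, c) \<in> \<theta>" using eq_equiv_class_iff[OF fin_congs_equiv[OF t(1)]] by auto
    then have "\<psi> `` {a} = \<psi> `` {c}" using equiv_class_eq[OF fin_congs_equiv[OF t(2)]] t(3) by blast
    then show ?thesis using c t by simp
  qed
  moreover have "prof_op dia f \<alpha> \<beta> \<in> extensional (fin_congs dia)" by (simp add: prof_op_def)
  ultimately show ?thesis unfolding prof_carrier_def PiE_iff by blast
qed

lemma prof_eqI: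
  assumes "\<alpha> \<in> prof_carrier dia" "\<beta> \<in> prof_carrier dia"
    and "\<And>\<theta>. \<theta> \<in> fin_congs dia \<Longrightarrow> \<alpha> \<theta> = \<beta> \<theta>"
  shows "\<alpha> = \<beta>"
  using assms(1,2) unfolding prof_carrier_def
  by (intro PiE_ext[where k = "fin_congs dia" and s = "\<lambda>\<theta>. UNIV // \<theta>"] assms(3)) simp_all

theorem profinite_completion_ops:
  assumes ab: "\<alpha> \<in> carrier (profinite_completion dia)" "\<beta> \<in> carrier (profinite_completion dia)"
  shows "\<alpha> \<sqinter>\<^bsub>profinite_completion dia\<^esub> \<beta> = prof_op dia inf \<alpha> \<beta>"
    and "\<alpha> \<squnion>\<^bsub>profinite_completion dia\<^esub> \<beta> = prof_op dia sup \<alpha> \<beta>"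
proof -
  let ?P = "profinite_completion dia" and ?F = "fin_congs dia"
  have P [simp]: "carrier ?P = prof_carrier dia" "x \<sqsubseteq>\<^bsub>?P\<^esub> y \<longleftrightarrow> prof_op dia inf x y = x"
    "x .=\<^bsub>?P\<^esub> y \<longleftrightarrow> x = y" for x y
    by (simp_all add: profinite_completion_def)
  have cl: "prof_op dia inf x y \<in> prof_carrier dia" "prof_op dia sup x y \<in> prof_carrier dia"
    if "x \<in> prof_carrier dia" "y \<in> prof_carrier dia" for x y
    using that by (auto intro!: prof_op_closed quot_inf_sup)
  have cls: "\<exists>a. x \<theta> = \<theta> `` {a}" if "x \<in> prof_carrier dia" "\<theta> \<in> ?F" for x \<theta>
    using prof_class[OF that] by metis
  have at: "prof_op dia f x y \<theta> = quot_op f \<theta> (x \<theta>) (y \<theta>)" if "\<theta> \<in> ?F" for f x y \<theta>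
    using that by (simp add: prof_op_def)
  have le_at: "x \<sqsubseteq>\<^bsub>?P\<^esub> y \<longleftrightarrow> (\<forall>\<theta>\<in>?F. quot_op inf \<theta> (x \<theta>) (y \<theta>) = x \<theta>)"
    if "x \<in> prof_carrier dia" "y \<in> prof_carrier dia" for x y
    unfolding P(2) using prof_eqI[OF cl(1)[OF that] that(1)] at[where f = inf] by metis
  have le_cls: "\<theta> `` {inf a b} = \<theta> `` {a}"
    if "x \<sqsubseteq>\<^bsub>?P\<^esub> y" "x \<in> prof_carrier dia" "y \<in> prof_carrier dia" "\<theta> \<in> ?F"
      "x \<theta> = \<theta> `` {a}" "y \<theta> = \<theta> `` {b}" for x y \<theta> a b
  proof -
    have "quot_op inf \<theta> (x \<theta>) (y \<theta>) = x \<theta>" using le_at that(1-4) by blast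
    then show ?thesis by (simp only: that(5,6) quot_inf_sup(1)[OF that(4)])
  qed
  interpret P: partial_order ?P
  proof
    fix x y z
    show "x \<sqsubseteq>\<^bsub>?P\<^esub> x" if x: "x \<in> carrier ?P"
    proof -
      have "quot_op inf \<theta> (x \<theta>) (x \<theta>) = x \<theta>" if t: "\<theta> \<in> ?F" for \<theta>
      proof -
        obtain a where "x \<theta> = \<theta> `` {a}" using cls[of x] x t by auto
        then show ?thesis by (simp add: quot_inf_sup(1)[OF t])
      qed
      then show ?thesis using x le_at by (simp del: P(2))
    qed
    show "x .=\<^bsub>?P\<^esub> y" if "x \<sqsubseteq>\<^bsub>?P\<^esub> y" "y \<sqsubseteq>\<^bsub>?P\<^esub> x" "x \<in> carrier ?P" "y \<in> carrier ?P"
    proof -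
      have xy: "x \<in> prof_carrier dia" "y \<in> prof_carrier dia" using that by simp_all
      have "x \<theta> = y \<theta>" if t: "\<theta> \<in> ?F" for \<theta>
      proof -
        obtain a b where ab: "x \<theta> = \<theta> `` {a}" "y \<theta> = \<theta> `` {b}"
          using cls[OF _ t] xy by meson
        then have "\<theta> `` {inf a b} = \<theta> `` {a}" "\<theta> `` {inf b a} = \<theta> `` {b}"
          using le_cls[OF \<open>x \<sqsubseteq>\<^bsub>?P\<^esub> y\<close> _ _ t] le_cls[OF \<open>y \<sqsubseteq>\<^bsub>?P\<^esub> x\<close> _ _ t] xy by blast+
        then show ?thesis by (simp add: ab inf.commute)
      qed
      then show ?thesis using prof_eqI that by simp blast
    qed
    show "x \<sqsubseteq>\<^bsub>?P\<^esub> z" if "x \<sqsubseteq>\<^bsub>?P\<^esub> y" "y \<sqsubseteq>\<^bsub>?P\<^esub> z" "x \<in> carrier ?P" "y \<in> carrier ?P" "z \<in> carrier ?P"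
    proof -
      have "quot_op inf \<theta> (x \<theta>) (z \<theta>) = x \<theta>" if t: "\<theta> \<in> ?F" for \<theta>
      proof -
        have xyz: "x \<in> prof_carrier dia" "y \<in> prof_carrier dia" "z \<in> prof_carrier dia"
          using \<open>x \<in> carrier ?P\<close> \<open>y \<in> carrier ?P\<close> \<open>z \<in> carrier ?P\<close> by simp_all
        obtain a b c where abc: "x \<theta> = \<theta> `` {a}" "y \<theta> = \<theta> `` {b}" "z \<theta> = \<theta> `` {c}"
          using cls[OF _ t] xyz by meson
        have ab: "\<theta> `` {inf a b} = \<theta> `` {a}" and bc: "\<theta> `` {inf b c} = \<theta> `` {b}"
          using le_cls[OF \<open>x \<sqsubseteq>\<^bsub>?P\<^esub> y\<close> _ _ t] le_cls[OF \<open>y \<sqsubseteq>\<^bsub>?P\<^esub> z\<close> _ _ t] xyz abc by blast+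
        have "\<theta> `` {inf a c} = quot_op inf \<theta> (\<theta> `` {inf a b}) (\<theta> `` {c})"
          by (simp add: ab quot_inf_sup(1)[OF t])
        also have "\<dots> = quot_op inf \<theta> (\<theta> `` {a}) (\<theta> `` {inf b c})"
          by (simp only: quot_inf_sup(1)[OF t] inf.assoc)
        also have "\<dots> = \<theta> `` {a}" by (simp add: ab bc quot_inf_sup(1)[OF t])
        finally show ?thesis by (simp add: abc quot_inf_sup(1)[OF t])
      qed
      then show ?thesis using that le_at by (simp del: P(2))
    qed
  qed (simp_all add: profinite_completion_def)
  have ab: "\<alpha> \<in> prof_carrier dia" "\<beta> \<in> prof_carrier dia" using ab by simp_all
  have "is_glb ?P (prof_op dia inf \<alpha> \<beta>) {\<alpha>, \<beta>}"
  proof (rule greatest_LowerI)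
    fix x assume "x \<in> {\<alpha>, \<beta>}"
    then have x: "x = \<alpha> \<or> x = \<beta>" by blast
    have "quot_op inf \<theta> (prof_op dia inf \<alpha> \<beta> \<theta>) (x \<theta>) = prof_op dia inf \<alpha> \<beta> \<theta>"
      if t: "\<theta> \<in> ?F" for \<theta>
    proof -
      obtain a b where "\<alpha> \<theta> = \<theta> `` {a}" "\<beta> \<theta> = \<theta> `` {b}" using cls[OF _ t] ab by meson
      then show ?thesis using x by (auto simp: at[OF t] quot_inf_sup[OF t] ac_simps)
    qed
    then show "prof_op dia inf \<alpha> \<beta> \<sqsubseteq>\<^bsub>?P\<^esub> x" using x ab cl le_at by (auto simp del: P(2))
  next
    fix y assume "y \<in> Lower ?P {\<alpha>, \<beta>}"
    then have y: "y \<in> prof_carrier dia" "y \<sqsubseteq>\<^bsub>?P\<^esub> \<alpha>" "y \<sqsubseteq>\<^bsub>?P\<^esub> \<beta>"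
      using ab by (auto simp: Lower_def simp del: P(2))
    have "quot_op inf \<theta> (y \<theta>) (prof_op dia inf \<alpha> \<beta> \<theta>) = y \<theta>" if t: "\<theta> \<in> ?F" for \<theta>
    proof -
      obtain a b c where abc: "\<alpha> \<theta> = \<theta> `` {a}" "\<beta> \<theta> = \<theta> `` {b}" "y \<theta> = \<theta> `` {c}"
        using cls[OF _ t] ab y(1) by meson
      have "\<theta> `` {inf c a} = \<theta> `` {c}" "\<theta> `` {inf c b} = \<theta> `` {c}"
        using le_cls[OF y(2) _ _ t] le_cls[OF y(3) _ _ t] y(1) ab abc by blast+
      then have "\<theta> `` {inf c (inf a b)} = \<theta> `` {c}"
        by (simp only: inf.assoc[symmetric] quot_inf_sup(1)[OF t, symmetric])
      then show ?thesis by (simp add: at[OF t] abc quot_inf_sup[OF t])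
    qed
    then show "y \<sqsubseteq>\<^bsub>?P\<^esub> prof_op dia inf \<alpha> \<beta>" using y ab cl le_at by (auto simp del: P(2))
  qed (use ab cl in auto)
  then show "\<alpha> \<sqinter>\<^bsub>?P\<^esub> \<beta> = prof_op dia inf \<alpha> \<beta>" unfolding meet_def by (rule P.inf_eqI)
  have "is_lub ?P (prof_op dia sup \<alpha> \<beta>) {\<alpha>, \<beta>}"
  proof (rule least_UpperI)
    fix x assume "x \<in> {\<alpha>, \<beta>}"
    then have x: "x = \<alpha> \<or> x = \<beta>" by blast
    have "quot_op inf \<theta> (x \<theta>) (prof_op dia sup \<alpha> \<beta> \<theta>) = x \<theta>" if t: "\<theta> \<in> ?F" for \<theta>
    proof -
      obtain a b where "\<alpha> \<theta> = \<theta> `` {a}" "\<beta> \<theta> = \<theta> `` {b}" using cls[OF _ t] ab by meson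
      then show ?thesis using x
        by (auto simp: at[OF t] quot_inf_sup[OF t] inf_sup_absorb sup.commute[of a b])
          (metis inf_sup_absorb sup.commute)+
    qed
    then show "x \<sqsubseteq>\<^bsub>?P\<^esub> prof_op dia sup \<alpha> \<beta>" using x ab cl le_at by (auto simp del: P(2))
  next
    fix y assume "y \<in> Upper ?P {\<alpha>, \<beta>}"
    then have y: "y \<in> prof_carrier dia" "\<alpha> \<sqsubseteq>\<^bsub>?P\<^esub> y" "\<beta> \<sqsubseteq>\<^bsub>?P\<^esub> y"
      using ab by (auto simp: Upper_def simp del: P(2))
    have "quot_op inf \<theta> (prof_op dia sup \<alpha> \<beta> \<theta>) (y \<theta>) = prof_op dia sup \<alpha> \<beta> \<theta>"
      if t: "\<theta> \<in> ?F" for \<theta>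
    proof -
      obtain a b c where abc: "\<alpha> \<theta> = \<theta> `` {a}" "\<beta> \<theta> = \<theta> `` {b}" "y \<theta> = \<theta> `` {c}"
        using cls[OF _ t] ab y(1) by meson
      have "\<theta> `` {inf a c} = \<theta> `` {a}" "\<theta> `` {inf b c} = \<theta> `` {b}"
        using le_cls[OF y(2) _ _ t] le_cls[OF y(3) _ _ t] y(1) ab abc by blast+
      then have "\<theta> `` {sup (inf a c) (inf b c)} = \<theta> `` {sup a b}"
        by (simp only: quot_inf_sup(2)[OF t, symmetric])
      then show ?thesis by (simp add: at[OF t] abc quot_inf_sup[OF t] inf_sup_distrib2)
    qed
    then show "prof_op dia sup \<alpha> \<beta> \<sqsubseteq>\<^bsub>?P\<^esub> y" using y ab cl le_at by (auto simp del: P(2))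
  qed (use ab cl in auto)
  then show "\<alpha> \<squnion>\<^bsub>?P\<^esub> \<beta> = prof_op dia sup \<alpha> \<beta>" unfolding join_def by (rule P.sup_eqI)
qed

end

theory Submission
  imports Defs
begin

text \<open>Joins in the profinite completion are computed coordinatewise, and at each coordinate they are
  finite joins. Hence, if the embedding is join-dense, the complement of the largest element that
  vanishes at \<open>\<theta>\<close> is itself embedded, and its preimage generates \<open>1/\<theta>\<close>.

  Conversely, if \<open>1/\<theta>\<close> is generated by \<open>p\<close>, the quotient by \<open>\<theta>\<close> is the finite interval \<open>[0, p]\<close>,
  and every element of a completion is pinned down modulo \<open>\<theta>\<close> by some \<open>e\<close> in this interval, from
  below by \<open>e\<close> and from above by \<open>e \<or> \<not>p\<close>. Residual finiteness combines these bounds into join- and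
  meet-density of the embedding, and into smoothness because \<open>\<Diamond>\<not>p\<close> is disjoint from \<open>p\<close>.\<close>

section \<open>Finite congruences\<close>

lemma fin_congs_refl: "\<theta> \<in> fin_congs dia \<Longrightarrow> (a, a) \<in> \<theta>"
  using fin_congs_equiv by (metis UNIV_I equiv_def refl_onD)

lemma fin_congs_sym: "\<theta> \<in> fin_congs dia \<Longrightarrow> (a, b) \<in> \<theta> \<Longrightarrow> (b, a) \<in> \<theta>"
  using fin_congs_equiv by (metis equiv_def symD)

lemma fin_congs_trans:
  "\<theta> \<in> fin_congs dia \<Longrightarrow> (a, b) \<in> \<theta> \<Longrightarrow> (b, c) \<in> \<theta> \<Longrightarrow> (a, c) \<in> \<theta>"
  using fin_congs_equiv by (metis equiv_def transD)

lemma fin_congs_inf: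
  "\<theta> \<in> fin_congs dia \<Longrightarrow> (a, a') \<in> \<theta> \<Longrightarrow> (b, b') \<in> \<theta> \<Longrightarrow> (inf a b, inf a' b') \<in> \<theta>"
  by (simp add: fin_congs_def modal_congruence_def)

lemma fin_congs_sup:
  "\<theta> \<in> fin_congs dia \<Longrightarrow> (a, a') \<in> \<theta> \<Longrightarrow> (b, b') \<in> \<theta> \<Longrightarrow> (sup a b, sup a' b') \<in> \<theta>"
  by (simp add: fin_congs_def modal_congruence_def)

lemma fin_congs_compl: "\<theta> \<in> fin_congs dia \<Longrightarrow> (a, a') \<in> \<theta> \<Longrightarrow> (- a, - a') \<in> \<theta>"
  by (simp add: fin_congs_def modal_congruence_def)

lemma fin_congs_dia: "\<theta> \<in> fin_congs dia \<Longrightarrow> (a, a') \<in> \<theta> \<Longrightarrow> (dia a, dia a') \<in> \<theta>"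
  by (simp add: fin_congs_def modal_congruence_def)

lemma fin_congs_class_eq_iff:
  "\<theta> \<in> fin_congs dia \<Longrightarrow> \<theta> `` {a} = \<theta> `` {b} \<longleftrightarrow> (a, b) \<in> \<theta>"
  using eq_equiv_class_iff[OF fin_congs_equiv] by blast

text \<open>Each class of the intersection is a class of \<theta> cut with a class of \<psi>, so
  there are finitely many. This allows coordinates at incomparable congruences to be compared
  through a common refinement.\<close>

lemma fin_congs_Int:
  assumes t: "\<theta> \<in> fin_congs dia" and p: "\<psi> \<in> fin_congs dia"
  shows "\<theta> \<inter> \<psi> \<in> fin_congs dia"
proof -
  have "UNIV // (\<theta> \<inter> \<psi>) \<subseteq> (\<lambda>(X, Y). X \<inter> Y) ` ((UNIV // \<theta>) \<times> (UNIV // \<psi>))"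
  proof
    fix X assume "X \<in> UNIV // (\<theta> \<inter> \<psi>)"
    then obtain a where "X = (\<theta> \<inter> \<psi>) `` {a}" by (rule quotientE)
    then have "X = \<theta> `` {a} \<inter> \<psi> `` {a}" by blast
    then show "X \<in> (\<lambda>(X, Y). X \<inter> Y) ` ((UNIV // \<theta>) \<times> (UNIV // \<psi>))"
      using quotientI[OF UNIV_I] by fastforce
  qed
  moreover have "finite ((UNIV // \<theta>) \<times> (UNIV // \<psi>))"
    using t p by (simp add: fin_congs_def)
  ultimately have "finite (UNIV // (\<theta> \<inter> \<psi>))" by (meson finite_imageI finite_subset)
  moreover have "equiv UNIV (\<theta> \<inter> \<psi>)"
  proof (rule equivI)
    show "refl (\<theta> \<inter> \<psi>)" using fin_congs_refl[OF t] fin_congs_refl[OF p] by (simp add: refl_on_def)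
    show "sym (\<theta> \<inter> \<psi>)" using fin_congs_sym[OF t] fin_congs_sym[OF p] by (auto intro: symI)
    show "trans (\<theta> \<inter> \<psi>)"
      using fin_congs_equiv[OF t] fin_congs_equiv[OF p] by (simp add: equiv_def trans_Int)
  qed simp
  ultimately show ?thesis
    using t p by (auto simp: fin_congs_def modal_congruence_def)
qed

text \<open>The order of the quotient by \<theta>, expressed on representatives.\<close>

definition cong_le :: "('a::boolean_algebra \<times> 'a) set \<Rightarrow> 'a \<Rightarrow> 'a \<Rightarrow> bool" where
  "cong_le \<theta> a b \<longleftrightarrow> (inf a b, a) \<in> \<theta>"

lemma cong_le_mono: "cong_le \<theta> a b \<Longrightarrow> \<theta> \<subseteq> \<psi> \<Longrightarrow> cong_le \<psi> a b"
  by (auto simp: cong_le_def)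

lemma cong_le_of_le: "\<theta> \<in> fin_congs dia \<Longrightarrow> a \<le> b \<Longrightarrow> cong_le \<theta> a b"
  by (simp add: cong_le_def inf.absorb1 fin_congs_refl)

lemma cong_le_antisym:
  assumes "\<theta> \<in> fin_congs dia" "cong_le \<theta> a b" "cong_le \<theta> b a"
  shows "(a, b) \<in> \<theta>"
  using assms unfolding cong_le_def
  by (metis fin_congs_sym fin_congs_trans inf.commute)

lemma cong_le_cong:
  assumes t: "\<theta> \<in> fin_congs dia" and "(a, a') \<in> \<theta>" "(b, b') \<in> \<theta>" "cong_le \<theta> a b"
  shows "cong_le \<theta> a' b'"
  using assms(2-) fin_congs_inf[OF t] fin_congs_sym[OF t] fin_congs_trans[OF t]
  unfolding cong_le_def by meson

lemma cong_le_trans: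
  assumes t: "\<theta> \<in> fin_congs dia" and ab: "cong_le \<theta> a b" and bc: "cong_le \<theta> b c"
  shows "cong_le \<theta> a c"
proof -
  have "cong_le \<theta> (inf a b) c"
    using fin_congs_inf[OF t fin_congs_refl[OF t] bc[unfolded cong_le_def]]
    by (simp add: cong_le_def inf.assoc)
  then show ?thesis
    using cong_le_cong[OF t _ fin_congs_refl[OF t]] ab unfolding cong_le_def by blast
qed

lemma cong_le_sup:
  assumes t: "\<theta> \<in> fin_congs dia" and "cong_le \<theta> a c" "cong_le \<theta> b c"
  shows "cong_le \<theta> (sup a b) c"
  using fin_congs_sup[OF t] assms(2-) by (simp add: cong_le_def inf_sup_distrib2)

text \<open>Inserting \<open>bot\<close> keeps the argument of \<open>Sup_fin\<close> nonempty, so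
  that an empty \<open>D\<close> also has its expected join.\<close>

lemma cong_le_Sup_fin:
  assumes t: "\<theta> \<in> fin_congs dia" and "finite D" and "\<And>d. d \<in> D \<Longrightarrow> cong_le \<theta> d c"
  shows "cong_le \<theta> (Sup_fin (insert bot D)) c"
  using assms(2,3)
proof (induction D rule: finite_induct)
  case empty
  show ?case by (simp add: cong_le_of_le[OF t])
next
  case (insert d D)
  have "Sup_fin (insert bot (insert d D)) = sup d (Sup_fin (insert bot D))"
    using insert.hyps by (subst insert_commute) simp
  then show ?case using insert cong_le_sup[OF t] by simp
qed

section \<open>Joins in the profinite completion\<close>

text \<open>Coordinates are congruence classes, so membership in \<open>\<alpha> \<theta>\<close>
  can serve throughout as "represents \<alpha> at \<theta>".\<close>

lemma prof_class_iff:
  assumes "\<alpha> \<in> prof_carrier dia" and t: "\<theta> \<in> fin_congs dia"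
  shows "a \<in> \<alpha> \<theta> \<longleftrightarrow> \<alpha> \<theta> = \<theta> `` {a}"
proof -
  obtain b where b: "\<alpha> \<theta> = \<theta> `` {b}" using prof_class[OF assms] by metis
  show ?thesis
    unfolding b fin_congs_class_eq_iff[OF t] by simp
qed

lemma prof_class_nonempty:
  assumes "\<alpha> \<in> prof_carrier dia" and t: "\<theta> \<in> fin_congs dia"
  obtains a where "a \<in> \<alpha> \<theta>"
  using prof_class[OF assms] prof_class_iff[OF assms] by metis

lemma prof_class_rel:
  assumes "\<alpha> \<in> prof_carrier dia" and t: "\<theta> \<in> fin_congs dia" and "a \<in> \<alpha> \<theta>"
  shows "b \<in> \<alpha> \<theta> \<longleftrightarrow> (a, b) \<in> \<theta>"
  using prof_class_iff[OF assms(1,2)] assms(3) by auto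

text \<open>This is the compatibility condition of \<open>prof_carrier\<close>, read on
  representatives.\<close>

lemma prof_class_mono:
  assumes "\<alpha> \<in> prof_carrier dia" "\<theta> \<in> fin_congs dia" "\<psi> \<in> fin_congs dia" "\<theta> \<subseteq> \<psi>" "a \<in> \<alpha> \<theta>"
  shows "a \<in> \<alpha> \<psi>"
proof -
  have "\<alpha> \<psi> = \<psi> `` {a}"
    using assms prof_class_iff[OF assms(1,2)] unfolding prof_carrier_def by blast
  then show ?thesis using prof_class_iff[OF assms(1,3)] by blast
qed

lemma prof_embed_carrier: "prof_embed dia a \<in> prof_carrier dia"
proof -
  have "prof_embed dia a \<psi> = \<psi> `` {b}"
    if t: "\<theta> \<in> fin_congs dia" and p: "\<psi> \<in> fin_congs dia" and "\<theta> \<subseteq> \<psi>"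
      "prof_embed dia a \<theta> = \<theta> `` {b}" for \<theta> \<psi> b
  proof -
    have "(a, b) \<in> \<theta>" using that fin_congs_class_eq_iff[OF t] by (simp add: prof_embed_def)
    then have "\<psi> `` {a} = \<psi> `` {b}" using \<open>\<theta> \<subseteq> \<psi>\<close> fin_congs_class_eq_iff[OF p] by blast
    then show ?thesis using p by (simp add: prof_embed_def)
  qed
  moreover have "prof_embed dia a \<in> (\<Pi>\<^sub>E \<theta>\<in>fin_congs dia. UNIV // \<theta>)"
    unfolding prof_embed_def by (auto intro: quotientI)
  ultimately show ?thesis unfolding prof_carrier_def by blast
qed

lemma prof_embed_mem_iff:
  "\<theta> \<in> fin_congs dia \<Longrightarrow> b \<in> prof_embed dia a \<theta> \<longleftrightarrow> (a, b) \<in> \<theta>"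
  by (simp add: prof_embed_def)

lemma profinite_completion_simps [simp]:
  "carrier (profinite_completion dia) = prof_carrier dia"
  "\<alpha> .=\<^bsub>profinite_completion dia\<^esub> \<beta> \<longleftrightarrow> \<alpha> = \<beta>"
  by (simp_all add: profinite_completion_def)

text \<open>The coordinatewise meet that defines the order is computed on representatives, and the
  outcome is the same for every choice of them.\<close>

lemma prof_le_iff:
  assumes a: "\<alpha> \<in> prof_carrier dia" and b: "\<beta> \<in> prof_carrier dia"
  shows "\<alpha> \<sqsubseteq>\<^bsub>profinite_completion dia\<^esub> \<beta> \<longleftrightarrow>
    (\<forall>\<theta>\<in>fin_congs dia. \<forall>a\<in>\<alpha> \<theta>. \<forall>b\<in>\<beta> \<theta>. cong_le \<theta> a b)"
proof -
  have "prof_op dia inf \<alpha> \<beta> \<in> prof_carrier dia"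
    using a b by (auto intro!: prof_op_closed quot_inf_sup)
  then have "\<alpha> \<sqsubseteq>\<^bsub>profinite_completion dia\<^esub> \<beta> \<longleftrightarrow>
      (\<forall>\<theta>\<in>fin_congs dia. prof_op dia inf \<alpha> \<beta> \<theta> = \<alpha> \<theta>)"
    using prof_eqI[OF _ a] by (auto simp: profinite_completion_def)
  moreover have "prof_op dia inf \<alpha> \<beta> \<theta> = \<alpha> \<theta> \<longleftrightarrow> (\<forall>a\<in>\<alpha> \<theta>. \<forall>b\<in>\<beta> \<theta>. cong_le \<theta> a b)"
    if t: "\<theta> \<in> fin_congs dia" for \<theta>
  proof -
    have *: "prof_op dia inf \<alpha> \<beta> \<theta> = \<alpha> \<theta> \<longleftrightarrow> cong_le \<theta> c d" if "c \<in> \<alpha> \<theta>" "d \<in> \<beta> \<theta>" for c d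
    proof -
      have cd: "\<alpha> \<theta> = \<theta> `` {c}" "\<beta> \<theta> = \<theta> `` {d}"
        using that prof_class_iff[OF a t] prof_class_iff[OF b t] by auto
      then have "prof_op dia inf \<alpha> \<beta> \<theta> = \<theta> `` {inf c d}"
        using t by (simp add: prof_op_def quot_inf_sup(1)[OF t])
      then show ?thesis
        by (simp only: cd fin_congs_class_eq_iff[OF t] cong_le_def)
    qed
    obtain c d where "c \<in> \<alpha> \<theta>" "d \<in> \<beta> \<theta>"
      using prof_class_nonempty[OF a t] prof_class_nonempty[OF b t] by metis
    then show ?thesis using * by blast
  qed
  ultimately show ?thesis by blast
qed

lemma prof_leD:
  assumes "\<alpha> \<sqsubseteq>\<^bsub>profinite_completion dia\<^esub> \<beta>" "\<alpha> \<in> prof_carrier dia" "\<beta> \<in> prof_carrier dia"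
    "\<theta> \<in> fin_congs dia" "a \<in> \<alpha> \<theta>" "b \<in> \<beta> \<theta>"
  shows "cong_le \<theta> a b"
  using assms prof_le_iff by blast

text \<open>One pair of representatives per coordinate suffices, because \<open>cong_le\<close> is
  invariant under \<theta>.\<close>

lemma prof_leI:
  assumes "\<alpha> \<in> prof_carrier dia" "\<beta> \<in> prof_carrier dia"
    and "\<And>\<theta>. \<theta> \<in> fin_congs dia \<Longrightarrow> \<exists>a\<in>\<alpha> \<theta>. \<exists>b\<in>\<beta> \<theta>. cong_le \<theta> a b"
  shows "\<alpha> \<sqsubseteq>\<^bsub>profinite_completion dia\<^esub> \<beta>"
  unfolding prof_le_iff[OF assms(1,2)]
proof (intro ballI)
  fix \<theta> a b assume t: "\<theta> \<in> fin_congs dia" and ab: "a \<in> \<alpha> \<theta>" "b \<in> \<beta> \<theta>"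
  obtain c d where cd: "c \<in> \<alpha> \<theta>" "d \<in> \<beta> \<theta>" "cong_le \<theta> c d" using assms(3)[OF t] by blast
  then have "(c, a) \<in> \<theta>" "(d, b) \<in> \<theta>"
    using prof_class_rel[OF assms(1) t cd(1)] prof_class_rel[OF assms(2) t cd(2)] ab by simp_all
  then show "cong_le \<theta> a b" using cong_le_cong[OF t _ _ cd(3)] by blast
qed

lemma prof_partial_order: "partial_order (profinite_completion dia)"
proof
  fix x y z
  let ?P = "profinite_completion dia"
  show "x \<sqsubseteq>\<^bsub>?P\<^esub> x" if "x \<in> carrier ?P"
  proof (rule prof_leI)
    show x: "x \<in> prof_carrier dia" "x \<in> prof_carrier dia" using that by simp_all
    fix \<theta> assume t: "\<theta> \<in> fin_congs dia"
    obtain a where "a \<in> x \<theta>" using prof_class_nonempty[OF x(1) t] .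
    then show "\<exists>a\<in>x \<theta>. \<exists>b\<in>x \<theta>. cong_le \<theta> a b"
      using cong_le_of_le[OF t order_refl] by blast
  qed
  show "x .=\<^bsub>?P\<^esub> y" if le: "x \<sqsubseteq>\<^bsub>?P\<^esub> y" "y \<sqsubseteq>\<^bsub>?P\<^esub> x" and "x \<in> carrier ?P" "y \<in> carrier ?P"
  proof -
    have x: "x \<in> prof_carrier dia" and y: "y \<in> prof_carrier dia" using that by simp_all
    have "x \<theta> = y \<theta>" if t: "\<theta> \<in> fin_congs dia" for \<theta>
    proof -
      obtain a b where ab: "a \<in> x \<theta>" "b \<in> y \<theta>"
        using prof_class_nonempty[OF x t] prof_class_nonempty[OF y t] by metis
      then have "(a, b) \<in> \<theta>"
        using cong_le_antisym[OF t] prof_leD[OF le(1) x y t] prof_leD[OF le(2) y x t] by blast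
      then show ?thesis
        using ab prof_class_iff[OF x t] prof_class_iff[OF y t] fin_congs_class_eq_iff[OF t] by metis
    qed
    then show ?thesis using prof_eqI[OF x y] by simp
  qed
  show "x \<sqsubseteq>\<^bsub>?P\<^esub> z"
    if le: "x \<sqsubseteq>\<^bsub>?P\<^esub> y" "y \<sqsubseteq>\<^bsub>?P\<^esub> z" and "x \<in> carrier ?P" "y \<in> carrier ?P" "z \<in> carrier ?P"
  proof -
    have xyz: "x \<in> prof_carrier dia" "y \<in> prof_carrier dia" "z \<in> prof_carrier dia"
      using that by simp_all
    show ?thesis
    proof (rule prof_leI)
      fix \<theta> assume t: "\<theta> \<in> fin_congs dia"
      obtain a where "a \<in> x \<theta>" using prof_class_nonempty[OF xyz(1) t] .
      moreover obtain b where "b \<in> y \<theta>" using prof_class_nonempty[OF xyz(2) t] .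
      moreover obtain c where "c \<in> z \<theta>" using prof_class_nonempty[OF xyz(3) t] .
      ultimately show "\<exists>a\<in>x \<theta>. \<exists>b\<in>z \<theta>. cong_le \<theta> a b"
        using prof_leD[OF le(1) xyz(1,2) t] prof_leD[OF le(2) xyz(2,3) t] cong_le_trans[OF t]
        by blast
    qed (use xyz in simp_all)
  qed
qed (simp_all, simp add: profinite_completion_def)

text \<open>Since every quotient is finite, the join at coordinate \<open>\<theta>\<close> is a finite join of representatives;
  finiteness is also what makes the coordinatewise joins compatible.\<close>

lemma prof_join_exists:
  assumes S: "S \<subseteq> prof_carrier dia"
  obtains s where "least (profinite_completion dia) s (Upper (profinite_completion dia) S)"
    and "\<forall>\<theta>\<in>fin_congs dia.
      \<exists>D. finite D \<and> D \<subseteq> (\<Union>\<alpha>\<in>S. \<alpha> \<theta>) \<and> Sup_fin (insert bot D) \<in> s \<theta>"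
proof -
  let ?P = "profinite_completion dia" and ?F = "fin_congs dia"
  \<comment> \<open>\<open>fj \<theta> c\<close> says that \<open>c\<close> represents the join at
    \<theta>. The upper-bound half makes it a bound; being a finite join of representatives makes it
    least.\<close>
  define fj where "fj \<theta> c \<longleftrightarrow>
    (\<exists>D. finite D \<and> D \<subseteq> (\<Union>\<alpha>\<in>S. \<alpha> \<theta>) \<and> c = Sup_fin (insert bot D)) \<and>
    (\<forall>\<alpha>\<in>S. \<forall>d\<in>\<alpha> \<theta>. cong_le \<theta> d c)" for \<theta> c
  have least: "cong_le \<theta> c u"
    if "fj \<theta> c" "\<theta> \<in> ?F" "\<And>\<alpha> d. \<alpha> \<in> S \<Longrightarrow> d \<in> \<alpha> \<theta> \<Longrightarrow> cong_le \<theta> d u" for \<theta> c u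
  proof -
    note ub = that(3)
    obtain D where D: "finite D" "D \<subseteq> (\<Union>\<alpha>\<in>S. \<alpha> \<theta>)" "c = Sup_fin (insert bot D)"
      using \<open>fj \<theta> c\<close> unfolding fj_def by blast
    have "cong_le \<theta> d u" if "d \<in> D" for d using D(2) ub that by blast
    then show ?thesis unfolding D(3) by (rule cong_le_Sup_fin[OF \<open>\<theta> \<in> ?F\<close> D(1)])
  qed
  have ex: "\<exists>c. fj \<theta> c" if t: "\<theta> \<in> ?F" for \<theta>
  proof -
    \<comment> \<open>The choice is made per class, not per member of \<open>S\<close>, so
      \<open>D\<close> is finite even when \<open>S\<close> is infinite.\<close>
    define D where "D = (\<lambda>X. SOME d. d \<in> X) ` (\<lambda>\<alpha>. \<alpha> \<theta>) ` S"
    have rep: "(SOME d. d \<in> \<alpha> \<theta>) \<in> \<alpha> \<theta>" if "\<alpha> \<in> S" for \<alpha>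
      using prof_class_nonempty[OF _ t, of \<alpha>] that S by (metis someI_ex subsetD)
    have "(\<lambda>\<alpha>. \<alpha> \<theta>) ` S \<subseteq> UNIV // \<theta>"
      using S t unfolding prof_carrier_def by (auto dest: PiE_mem)
    then have fin: "finite D"
      using t finite_subset unfolding D_def fin_congs_def by blast
    have "cong_le \<theta> d (Sup_fin (insert bot D))" if a: "\<alpha> \<in> S" and d: "d \<in> \<alpha> \<theta>" for \<alpha> d
    proof -
      let ?e = "SOME d. d \<in> \<alpha> \<theta>"
      have ac: "\<alpha> \<in> prof_carrier dia" using a S by blast
      have "?e \<in> D" using a unfolding D_def by blast
      then have "?e \<le> Sup_fin (insert bot D)" using fin by (intro Sup_fin.coboundedI) auto
      moreover have "(?e, d) \<in> \<theta>" using prof_class_rel[OF ac t rep[OF a]] d by blast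
      ultimately show ?thesis
        using cong_le_cong[OF t _ fin_congs_refl[OF t]] cong_le_of_le[OF t] by blast
    qed
    moreover have "D \<subseteq> (\<Union>\<alpha>\<in>S. \<alpha> \<theta>)" using rep unfolding D_def by blast
    ultimately show ?thesis using fin unfolding fj_def by blast
  qed
  have uniq: "(c, c') \<in> \<theta>" if "fj \<theta> c" "fj \<theta> c'" "\<theta> \<in> ?F" for \<theta> c c'
  proof (rule cong_le_antisym[OF that(3)])
    show "cong_le \<theta> c c'" by (rule least[OF that(1,3)]) (use that(2) in \<open>simp add: fj_def\<close>)
    show "cong_le \<theta> c' c" by (rule least[OF that(2,3)]) (use that(1) in \<open>simp add: fj_def\<close>)
  qed
  \<comment> \<open>The same finite set \<open>D\<close> works at the coarser \<psi>, since
    representatives at \<theta> remain representatives there. Compatibility of \<open>s\<close>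
    rests on this.\<close>
  have up: "fj \<psi> c" if c: "fj \<theta> c" and t: "\<theta> \<in> ?F" and p: "\<psi> \<in> ?F" and tp: "\<theta> \<subseteq> \<psi>" for \<theta> \<psi> c
  proof -
    have "(\<Union>\<alpha>\<in>S. \<alpha> \<theta>) \<subseteq> (\<Union>\<alpha>\<in>S. \<alpha> \<psi>)"
      using prof_class_mono[OF _ t p tp] S by blast
    moreover have "cong_le \<psi> d c" if a: "\<alpha> \<in> S" and d: "d \<in> \<alpha> \<psi>" for \<alpha> d
    proof -
      have ac: "\<alpha> \<in> prof_carrier dia" using a S by blast
      obtain e where e: "e \<in> \<alpha> \<theta>" using prof_class_nonempty[OF ac t] by blast
      then have "(e, d) \<in> \<psi>"
        using prof_class_mono[OF ac t p tp] prof_class_rel[OF ac p] d by blast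
      moreover have "cong_le \<psi> e c" using c e a cong_le_mono[OF _ tp] unfolding fj_def by blast
      ultimately show ?thesis using cong_le_cong[OF p _ fin_congs_refl[OF p]] by blast
    qed
    moreover obtain D where "finite D" "D \<subseteq> (\<Union>\<alpha>\<in>S. \<alpha> \<theta>)" "c = Sup_fin (insert bot D)"
      using c unfolding fj_def by blast
    ultimately show ?thesis
      unfolding fj_def by (intro conjI exI[of _ D] ballI) (auto intro: order_trans)
  qed
  define s where "s = (\<lambda>\<theta>\<in>?F. \<theta> `` {SOME c. fj \<theta> c})"
  have s_eq: "s \<theta> = \<theta> `` {c}" if "fj \<theta> c" "\<theta> \<in> ?F" for \<theta> c
  proof -
    have "fj \<theta> (SOME c. fj \<theta> c)" using that(1) by (rule someI)
    then show ?thesis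
      using uniq[OF _ that] that(2) fin_congs_class_eq_iff[OF that(2)] by (simp add: s_def)
  qed
  have s_mem: "c \<in> s \<theta>" if "fj \<theta> c" "\<theta> \<in> ?F" for \<theta> c
    using s_eq[OF that] fin_congs_refl[OF that(2)] by simp
  have s: "s \<in> prof_carrier dia"
  proof -
    have "s \<in> (\<Pi>\<^sub>E \<theta>\<in>?F. UNIV // \<theta>)" by (auto simp: s_def intro: quotientI)
    moreover have "s \<psi> = \<psi> `` {a}"
      if t: "\<theta> \<in> ?F" and p: "\<psi> \<in> ?F" and tp: "\<theta> \<subseteq> \<psi>" and a: "s \<theta> = \<theta> `` {a}" for \<theta> \<psi> a
    proof -
      obtain c where c: "fj \<theta> c" using ex[OF t] by blast
      then have "(c, a) \<in> \<theta>" using a s_eq[OF c t] fin_congs_class_eq_iff[OF t] by simp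
      then have "\<psi> `` {c} = \<psi> `` {a}" using tp fin_congs_class_eq_iff[OF p] by blast
      then show ?thesis using s_eq[OF up[OF c t p tp] p] by simp
    qed
    ultimately show ?thesis unfolding prof_carrier_def by blast
  qed
  show thesis
  proof (rule that)
    show "least ?P s (Upper ?P S)"
    proof (rule least_UpperI)
      show "\<alpha> \<sqsubseteq>\<^bsub>?P\<^esub> s" if a: "\<alpha> \<in> S" for \<alpha>
      proof (rule prof_leI)
        fix \<theta> assume t: "\<theta> \<in> ?F"
        obtain c where c: "fj \<theta> c" using ex[OF t] by blast
        obtain d where "d \<in> \<alpha> \<theta>" using prof_class_nonempty[OF _ t] a S by blast
        then show "\<exists>a\<in>\<alpha> \<theta>. \<exists>b\<in>s \<theta>. cong_le \<theta> a b"
          using c s_mem[OF c t] a unfolding fj_def by blast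
      qed (use a S s in auto)
      show "s \<sqsubseteq>\<^bsub>?P\<^esub> \<beta>" if "\<beta> \<in> Upper ?P S" for \<beta>
      proof (rule prof_leI)
        show b: "\<beta> \<in> prof_carrier dia" using that by (simp add: Upper_def)
        have ub: "\<alpha> \<sqsubseteq>\<^bsub>?P\<^esub> \<beta>" if "\<alpha> \<in> S" for \<alpha>
          using \<open>\<beta> \<in> Upper ?P S\<close> that S by (auto simp: Upper_def)
        fix \<theta> assume t: "\<theta> \<in> ?F"
        obtain c where c: "fj \<theta> c" using ex[OF t] by blast
        obtain u where u: "u \<in> \<beta> \<theta>" using prof_class_nonempty[OF b t] by blast
        have "cong_le \<theta> c u"
          using least[OF c t] prof_leD[OF ub _ b t _ u] S by blast
        then show "\<exists>a\<in>s \<theta>. \<exists>b\<in>\<beta> \<theta>. cong_le \<theta> a b" using u s_mem[OF c t] by blast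
      qed (rule s)
    qed (use S s in auto)
    show "\<forall>\<theta>\<in>?F. \<exists>D. finite D \<and> D \<subseteq> (\<Union>\<alpha>\<in>S. \<alpha> \<theta>) \<and> Sup_fin (insert bot D) \<in> s \<theta>"
    proof
      fix \<theta> assume t: "\<theta> \<in> ?F"
      obtain c where c: "fj \<theta> c" using ex[OF t] by blast
      then show "\<exists>D. finite D \<and> D \<subseteq> (\<Union>\<alpha>\<in>S. \<alpha> \<theta>) \<and> Sup_fin (insert bot D) \<in> s \<theta>"
        using s_mem[OF c t] unfolding fj_def by blast
    qed
  qed
qed

text \<open>Arbitrary joins yield arbitrary meets: the infimum of a set is the supremum of its lower
  bounds.\<close>

lemma prof_complete_lattice: "complete_lattice (profinite_completion dia)"
proof -
  let ?P = "profinite_completion dia"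
  interpret P: partial_order ?P by (rule prof_partial_order)
  have sup: "\<exists>s. least ?P s (Upper ?P A)" if "A \<subseteq> carrier ?P" for A
    using prof_join_exists[of A dia] that by (metis profinite_completion_simps(1))
  have inf: "\<exists>i. greatest ?P i (Lower ?P A)" if A: "A \<subseteq> carrier ?P" for A
  proof -
    obtain s where s: "least ?P s (Upper ?P (Lower ?P A))" using sup[OF Lower_closed] by blast
    have "A \<subseteq> Upper ?P (Lower ?P A)" using A by (auto simp: Upper_def Lower_def)
    then have "greatest ?P s (Lower ?P A)"
      using s A by (auto simp: least_def greatest_def Upper_def Lower_def)
    then show ?thesis by blast
  qed
  show ?thesis by (rule P.complete_latticeI) (use sup inf in blast)+
qed

section \<open>Principal congruences\<close>

text \<open>If \<open>c\<close> and \<open>d\<close> are congruent, then \<not>c \<or> d lies in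
  1/\<theta>, hence above \<open>p\<close>, which gives c \<and> p \<le> d. Conversely
  \<open>p\<close> is congruent to 1, so every \<open>c\<close> is congruent to c \<and> p.\<close>

lemma principal_cong_iff:
  assumes t: "\<theta> \<in> fin_congs dia" and p: "\<theta> `` {top} = {b. b \<ge> p}"
  shows "(a, b) \<in> \<theta> \<longleftrightarrow> inf a p = inf b p"
proof
  have le: "inf c p \<le> d" if "(c, d) \<in> \<theta>" for c d
  proof -
    have "(sup (- c) c, sup (- c) d) \<in> \<theta>"
      using fin_congs_sup[OF t fin_congs_refl[OF t] that] .
    then have "p \<le> sup (- c) d" using p by auto
    then show ?thesis using shunt1[of p c d] by (simp add: inf.commute)
  qed
  show "inf a p = inf b p" if "(a, b) \<in> \<theta>"
    using le[OF that] le[OF fin_congs_sym[OF t that]] by (simp add: order_antisym)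
  have top: "(top, p) \<in> \<theta>" using p by auto
  have "(c, inf c p) \<in> \<theta>" for c
    using fin_congs_inf[OF t fin_congs_refl[OF t, of c] top] by simp
  then show "(a, b) \<in> \<theta>" if "inf a p = inf b p"
    using that fin_congs_trans[OF t] fin_congs_sym[OF t] by metis
qed

lemma principal_cong_le_iff:
  assumes "\<theta> \<in> fin_congs dia" and "\<theta> `` {top} = {b. b \<ge> p}"
  shows "cong_le \<theta> a b \<longleftrightarrow> inf a p \<le> b"
  unfolding cong_le_def principal_cong_iff[OF assms]
  by (metis inf.absorb_iff1 inf.assoc inf.commute)

text \<open>Distinct elements below \<open>p\<close> lie in distinct classes of \<theta>.\<close>

lemma principal_cong_finite:
  assumes t: "\<theta> \<in> fin_congs dia" and p: "\<theta> `` {top} = {b. b \<ge> p}"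
  shows "finite {..p}"
proof -
  have "inj_on (\<lambda>a. \<theta> `` {a}) {..p}"
    by (rule inj_onI)
      (simp add: fin_congs_class_eq_iff[OF t] principal_cong_iff[OF t p] inf.absorb1)
  moreover have "(\<lambda>a. \<theta> `` {a}) ` {..p} \<subseteq> UNIV // \<theta>" by (auto intro: quotientI)
  moreover have "finite (UNIV // \<theta>)" using t by (simp add: fin_congs_def)
  ultimately show ?thesis by (meson finite_imageD finite_subset)
qed

text \<open>Separating \<open>inf a b\<close> from \<open>a\<close> reduces an inequality in the
  algebra to its finite quotients.\<close>

lemma residually_finite_leI:
  assumes "residually_finite dia" and le: "\<And>\<theta>. \<theta> \<in> fin_congs dia \<Longrightarrow> cong_le \<theta> a b"
  shows "a \<le> b"
proof (rule ccontr)
  assume "\<not> a \<le> b"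
  then have "inf a b \<noteq> a" by (simp add: inf.absorb_iff1)
  then obtain \<theta> where t: "\<theta> \<in> fin_congs dia" "\<theta> `` {inf a b} \<noteq> \<theta> `` {a}"
    using assms(1) unfolding residually_finite_def by blast
  then show False using le[OF t(1)] fin_congs_class_eq_iff[OF t(1)] by (simp add: cong_le_def)
qed

section \<open>Principal finite congruences give a smooth MacNeille completion\<close>

text \<open>If \<open>1/\<theta>\<close> is generated by \<open>p\<close> and \<open>c\<close> represents \<open>\<alpha>\<close> at \<open>\<theta>\<close>, the bounds are \<open>c \<and> p\<close>
  and \<open>(c \<and> p) \<or> \<not>p\<close>.\<close>

lemma prof_embed_between:
  assumes t: "\<theta> \<in> fin_congs dia" and p: "\<theta> `` {top} = {b. b \<ge> p}"
    and \<alpha>: "\<alpha> \<in> prof_carrier dia"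
  obtains e e' where "e \<in> \<alpha> \<theta>" "e' \<in> \<alpha> \<theta>"
    and "prof_embed dia e \<sqsubseteq>\<^bsub>profinite_completion dia\<^esub> \<alpha>"
    and "\<alpha> \<sqsubseteq>\<^bsub>profinite_completion dia\<^esub> prof_embed dia e'"
proof -
  obtain c where c: "c \<in> \<alpha> \<theta>" using prof_class_nonempty[OF \<alpha> t] .
  define e where "e = inf c p"
  \<comment> \<open>A representative at the common refinement represents \<alpha> at both
    congruences. Its trace on \<open>p\<close> is therefore \<open>e\<close>, which places it
    between \<open>e\<close> and e \<or> \<not>p at every coordinate \<psi>.\<close>
  have common: "\<exists>d\<in>\<alpha> \<psi>. inf d p = e" if s: "\<psi> \<in> fin_congs dia" for \<psi>
  proof -
    have ts: "\<theta> \<inter> \<psi> \<in> fin_congs dia" using fin_congs_Int[OF t s] .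
    obtain d where d: "d \<in> \<alpha> (\<theta> \<inter> \<psi>)" using prof_class_nonempty[OF \<alpha> ts] .
    have dt: "d \<in> \<alpha> \<theta>" using prof_class_mono[OF \<alpha> ts t _ d] by blast
    have ds: "d \<in> \<alpha> \<psi>" using prof_class_mono[OF \<alpha> ts s _ d] by blast
    have "(d, c) \<in> \<theta>" using prof_class_rel[OF \<alpha> t dt] c by simp
    then have "inf d p = e" unfolding e_def principal_cong_iff[OF t p] .
    then show ?thesis using ds by blast
  qed
  have mem: "x \<in> \<alpha> \<theta>" if "inf x p = e" for x
    using prof_class_rel[OF \<alpha> t c] principal_cong_iff[OF t p] that by (simp add: e_def)
  show thesis
  proof (rule that)
    show "e \<in> \<alpha> \<theta>" by (rule mem) (simp add: e_def inf.assoc)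
    show "sup e (- p) \<in> \<alpha> \<theta>" by (rule mem) (simp add: e_def inf_sup_distrib2 inf.assoc)
    show "prof_embed dia e \<sqsubseteq>\<^bsub>profinite_completion dia\<^esub> \<alpha>"
    proof (rule prof_leI[OF prof_embed_carrier \<alpha>])
      fix \<psi> assume s: "\<psi> \<in> fin_congs dia"
      obtain d where d: "d \<in> \<alpha> \<psi>" "inf d p = e" using common[OF s] by blast
      have "e \<le> d" by (simp add: d(2)[symmetric])
      then show "\<exists>x\<in>prof_embed dia e \<psi>. \<exists>b\<in>\<alpha> \<psi>. cong_le \<psi> x b"
        using d(1) fin_congs_refl[OF s] prof_embed_mem_iff[OF s] cong_le_of_le[OF s] by blast
    qed
    show "\<alpha> \<sqsubseteq>\<^bsub>profinite_completion dia\<^esub> prof_embed dia (sup e (- p))"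
    proof (rule prof_leI[OF \<alpha> prof_embed_carrier])
      fix \<psi> assume s: "\<psi> \<in> fin_congs dia"
      obtain d where d: "d \<in> \<alpha> \<psi>" "inf d p = e" using common[OF s] by blast
      have "d \<le> sup e (- p)" by (simp add: d(2)[symmetric] sup_inf_distrib2)
      then show "\<exists>b\<in>\<alpha> \<psi>. \<exists>x\<in>prof_embed dia (sup e (- p)) \<psi>. cong_le \<psi> b x"
        using d(1) fin_congs_refl[OF s] prof_embed_mem_iff[OF s] cong_le_of_le[OF s] by blast
    qed
  qed
qed

text \<open>Residual finiteness makes the embedding injective. For density, each \<theta> has
  embedded elements below and above \<open>x\<close> that agree with \<open>x\<close> at \<theta>,
  so a bound of all such elements compares correctly with \<open>x\<close> at every
  coordinate.\<close>

lemma prof_macneille_completion: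
  assumes rf: "residually_finite dia"
    and pr: "\<forall>\<theta>\<in>fin_congs dia. \<exists>a. \<theta> `` {top} = {b. b \<ge> a}"
  shows "macneille_completion (prof_embed dia) (profinite_completion dia)"
proof -
  let ?P = "profinite_completion dia" and ?m = "prof_embed dia"
  interpret P: complete_lattice ?P by (rule prof_complete_lattice)
  have inj: "inj ?m"
  proof (rule injI, rule ccontr)
    fix a b assume eq: "?m a = ?m b" and "a \<noteq> b"
    then obtain \<theta> where "\<theta> \<in> fin_congs dia" "\<theta> `` {a} \<noteq> \<theta> `` {b}"
      using rf unfolding residually_finite_def by blast
    then show False using fun_cong[OF eq, of \<theta>] by (simp add: prof_embed_def)
  qed
  have op: "?m (f a b) = prof_op dia f (?m a) (?m b)"
    if "\<And>\<theta>. \<theta> \<in> fin_congs dia \<Longrightarrow> quot_op f \<theta> (\<theta> `` {a}) (\<theta> `` {b}) = \<theta> `` {f a b}" for f a b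
    using that by (simp add: prof_embed_def prof_op_def restrict_def fun_eq_iff)
  have mc: "?m a \<in> carrier ?P" for a by (simp add: prof_embed_carrier)
  have "completion ?m ?P"
    unfolding completion_def
    using inj mc profinite_completion_ops[OF mc mc] op quot_inf_sup P.complete_lattice_axioms
    by (metis image_subsetI)
  moreover have "x = \<Squnion>\<^bsub>?P\<^esub> {?m a |a. ?m a \<sqsubseteq>\<^bsub>?P\<^esub> x}" if x: "x \<in> prof_carrier dia" for x
  proof (rule P.sup_eqI[symmetric], rule least_UpperI)
    fix y assume y: "y \<in> Upper ?P {?m a |a. ?m a \<sqsubseteq>\<^bsub>?P\<^esub> x}"
    then have yc: "y \<in> prof_carrier dia" by (simp add: Upper_def)
    have ub: "?m a \<sqsubseteq>\<^bsub>?P\<^esub> y" if "?m a \<sqsubseteq>\<^bsub>?P\<^esub> x" for a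
      using y that mc unfolding Upper_def by blast
    show "x \<sqsubseteq>\<^bsub>?P\<^esub> y"
    proof (rule prof_leI[OF x yc])
      fix \<theta> assume t: "\<theta> \<in> fin_congs dia"
      obtain p where p: "\<theta> `` {top} = {b. b \<ge> p}" using pr t by blast
      obtain e where e: "e \<in> x \<theta>" "?m e \<sqsubseteq>\<^bsub>?P\<^esub> x" using prof_embed_between[OF t p x] by metis
      obtain b where b: "b \<in> y \<theta>" using prof_class_nonempty[OF yc t] .
      have "e \<in> ?m e \<theta>" using fin_congs_refl[OF t] prof_embed_mem_iff[OF t] by simp
      then have "cong_le \<theta> e b" using prof_leD[OF ub[OF e(2)] prof_embed_carrier yc t _ b] by simp
      then show "\<exists>a\<in>x \<theta>. \<exists>b\<in>y \<theta>. cong_le \<theta> a b" using e b by blast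
    qed
  qed (use x mc in auto)
  moreover have "x = \<Sqinter>\<^bsub>?P\<^esub> {?m a |a. x \<sqsubseteq>\<^bsub>?P\<^esub> ?m a}" if x: "x \<in> prof_carrier dia" for x
  proof (rule P.inf_eqI[symmetric], rule greatest_LowerI)
    fix y assume y: "y \<in> Lower ?P {?m a |a. x \<sqsubseteq>\<^bsub>?P\<^esub> ?m a}"
    then have yc: "y \<in> prof_carrier dia" by (simp add: Lower_def)
    have lb: "y \<sqsubseteq>\<^bsub>?P\<^esub> ?m a" if "x \<sqsubseteq>\<^bsub>?P\<^esub> ?m a" for a
      using y that mc unfolding Lower_def by blast
    show "y \<sqsubseteq>\<^bsub>?P\<^esub> x"
    proof (rule prof_leI[OF yc x])
      fix \<theta> assume t: "\<theta> \<in> fin_congs dia"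
      obtain p where p: "\<theta> `` {top} = {b. b \<ge> p}" using pr t by blast
      obtain e where e: "e \<in> x \<theta>" "x \<sqsubseteq>\<^bsub>?P\<^esub> ?m e" using prof_embed_between[OF t p x] by metis
      obtain b where b: "b \<in> y \<theta>" using prof_class_nonempty[OF yc t] .
      have "e \<in> ?m e \<theta>" using fin_congs_refl[OF t] prof_embed_mem_iff[OF t] by simp
      then have "cong_le \<theta> b e" using prof_leD[OF lb[OF e(2)] yc prof_embed_carrier t b] by simp
      then show "\<exists>a\<in>y \<theta>. \<exists>b\<in>x \<theta>. cong_le \<theta> a b" using e b by blast
    qed
  qed (use x mc in auto)
  ultimately show ?thesis by (simp add: macneille_completion_def)
qed

lemma modal_algebra_mono:
  assumes "modal_algebra dia" "a \<le> b"
  shows "dia a \<le> dia b"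
  using modal_algebra.dia_sup[OF assms(1), of a b] assms(2) by (simp add: le_iff_sup)

text \<open>For \<open>x\<close> in the completion and \<open>1/\<theta>\<close> generated by \<open>p\<close>, the join \<open>e\<close> of the finitely many
  elements below \<open>p\<close> and \<open>x\<close> satisfies \<open>e \<le> x \<le> e \<or> \<not>p\<close>; since \<open>\<Diamond>\<not>p\<close> is disjoint from \<open>p\<close>,
  the two extensions of \<open>\<Diamond>\<close> agree modulo \<open>\<theta>\<close>.\<close>

lemma smooth_of_principal:
  assumes ma: "modal_algebra dia" and M: "macneille_completion m C"
    and rf: "residually_finite dia"
    and pr: "\<forall>\<theta>\<in>fin_congs dia. \<exists>a. \<theta> `` {top} = {b. b \<ge> a}"
  shows "smooth m C dia"
  unfolding smooth_def
proof
  fix x assume x: "x \<in> carrier C"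
  have m: "completion m C" using M by (simp add: macneille_completion_def)
  interpret C: complete_lattice C using m by (simp add: completion_def)
  have mc: "m a \<in> carrier C" for a using m by (auto simp: completion_def)
  note le_iff = completion_le_iff[OF m]
  have join: "y = \<Squnion>\<^bsub>C\<^esub> {m a |a. m a \<sqsubseteq>\<^bsub>C\<^esub> y}" and meet: "y = \<Sqinter>\<^bsub>C\<^esub> {m a |a. y \<sqsubseteq>\<^bsub>C\<^esub> m a}"
    if "y \<in> carrier C" for y
    using M that unfolding macneille_completion_def by blast+
  let ?l = "lower_ext m C dia x" and ?u = "upper_ext m C dia x"
  have lc: "?l \<in> carrier C" unfolding lower_ext_def by (rule C.sup_closed) (auto simp: mc)
  have uc: "?u \<in> carrier C" unfolding upper_ext_def by (rule C.inf_closed) (auto simp: mc)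
  have "?l \<sqsubseteq>\<^bsub>C\<^esub> ?u"
    unfolding lower_ext_def
  proof (rule C.sup_least)
    fix y assume "y \<in> {m (dia a) |a. m a \<sqsubseteq>\<^bsub>C\<^esub> x}"
    then obtain a where a: "y = m (dia a)" "m a \<sqsubseteq>\<^bsub>C\<^esub> x" by blast
    show "y \<sqsubseteq>\<^bsub>C\<^esub> ?u"
      unfolding upper_ext_def
    proof (rule C.inf_greatest)
      fix z assume "z \<in> {m (dia a) |a. x \<sqsubseteq>\<^bsub>C\<^esub> m a}"
      then obtain b where b: "z = m (dia b)" "x \<sqsubseteq>\<^bsub>C\<^esub> m b" by blast
      have "m a \<sqsubseteq>\<^bsub>C\<^esub> m b" using C.le_trans[OF a(2) b(2)] mc x by simp
      then show "y \<sqsubseteq>\<^bsub>C\<^esub> z" using modal_algebra_mono[OF ma] by (simp add: a b le_iff)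
    qed (auto simp: a mc)
  qed (auto simp: mc uc)
  moreover have "?u \<sqsubseteq>\<^bsub>C\<^esub> ?l"
  proof -
    \<comment> \<open>By join-density at the upper extension and meet-density at the lower one, it
      suffices to compare embedded elements \<open>b\<close> and \<open>c\<close>.\<close>
    have "m b \<sqsubseteq>\<^bsub>C\<^esub> m c" if b: "m b \<sqsubseteq>\<^bsub>C\<^esub> ?u" and c: "?l \<sqsubseteq>\<^bsub>C\<^esub> m c" for b c
    proof -
      have b_le: "b \<le> dia a" if "x \<sqsubseteq>\<^bsub>C\<^esub> m a" for a
      proof -
        have "?u \<sqsubseteq>\<^bsub>C\<^esub> m (dia a)"
          unfolding upper_ext_def by (rule C.inf_lower) (use that mc in auto)
        then have "m b \<sqsubseteq>\<^bsub>C\<^esub> m (dia a)" using C.le_trans[OF b] mc uc by simp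
        then show ?thesis by (simp add: le_iff)
      qed
      have le_c: "dia a \<le> c" if "m a \<sqsubseteq>\<^bsub>C\<^esub> x" for a
      proof -
        have "m (dia a) \<sqsubseteq>\<^bsub>C\<^esub> ?l"
          unfolding lower_ext_def by (rule C.sup_upper) (use that mc in auto)
        then have "m (dia a) \<sqsubseteq>\<^bsub>C\<^esub> m c" using C.le_trans[OF _ c] mc lc by simp
        then show ?thesis by (simp add: le_iff)
      qed
      have "b \<le> c"
      proof (rule residually_finite_leI[OF rf])
        fix \<theta> assume t: "\<theta> \<in> fin_congs dia"
        obtain p where p: "\<theta> `` {top} = {b. b \<ge> p}" using pr t by blast
        define D where "D = {a. a \<le> p \<and> m a \<sqsubseteq>\<^bsub>C\<^esub> x}"
        define e where "e = Sup_fin (insert bot D)"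
        have fin: "finite D"
          using principal_cong_finite[OF t p] by (rule finite_subset[rotated]) (auto simp: D_def)
        have le_e: "a \<le> e" if "a \<in> D" for a
          unfolding e_def using fin that by (intro Sup_fin.coboundedI) auto
        \<comment> \<open>Meet-density reduces this to embedded elements above \<open>x\<close>;
          there \<open>bot\<close> and the members of \<open>D\<close> are compared inside the
          algebra.\<close>
        have "m e \<sqsubseteq>\<^bsub>C\<^esub> \<Sqinter>\<^bsub>C\<^esub> {m a |a. x \<sqsubseteq>\<^bsub>C\<^esub> m a}"
        proof (rule C.inf_greatest)
          fix y assume "y \<in> {m a |a. x \<sqsubseteq>\<^bsub>C\<^esub> m a}"
          then obtain a where a: "y = m a" "x \<sqsubseteq>\<^bsub>C\<^esub> m a" by blast
          have "d \<le> a" if "d \<in> insert bot D" for d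
          proof (cases "d = bot")
            case False
            then have "m d \<sqsubseteq>\<^bsub>C\<^esub> x" using that by (simp add: D_def)
            then have "m d \<sqsubseteq>\<^bsub>C\<^esub> m a" using C.le_trans[OF _ a(2)] mc x by simp
            then show ?thesis by (simp add: le_iff)
          qed simp
          then have "e \<le> a" unfolding e_def using fin by (intro Sup_fin.boundedI) auto
          then show "m e \<sqsubseteq>\<^bsub>C\<^esub> y" by (simp add: a le_iff)
        qed (auto simp: mc)
        then have ex: "m e \<sqsubseteq>\<^bsub>C\<^esub> x" using meet[OF x] by simp
        have "\<Squnion>\<^bsub>C\<^esub> {m a |a. m a \<sqsubseteq>\<^bsub>C\<^esub> x} \<sqsubseteq>\<^bsub>C\<^esub> m (sup e (- p))"
        proof (rule C.sup_least)
          fix y assume "y \<in> {m a |a. m a \<sqsubseteq>\<^bsub>C\<^esub> x}"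
          then obtain a where a: "y = m a" "m a \<sqsubseteq>\<^bsub>C\<^esub> x" by blast
          have "m (inf a p) \<sqsubseteq>\<^bsub>C\<^esub> m a" by (simp add: le_iff)
          then have "m (inf a p) \<sqsubseteq>\<^bsub>C\<^esub> x" using C.le_trans[OF _ a(2)] mc x by simp
          then have "inf a p \<le> e" by (intro le_e) (simp add: D_def)
          then have "a \<le> sup e (- p)" using shunt1[of a p e] by (simp add: sup.commute)
          then show "y \<sqsubseteq>\<^bsub>C\<^esub> m (sup e (- p))" by (simp add: a le_iff)
        qed (auto simp: mc)
        then have "x \<sqsubseteq>\<^bsub>C\<^esub> m (sup e (- p))" using join[OF x] by simp
        \<comment> \<open>The element e \<or> \<not>p now takes part in the meet defining the upper
          extension, and the operator splits over this join.\<close>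
        then have "b \<le> sup (dia e) (dia (- p))"
          using b_le modal_algebra.dia_sup[OF ma] by metis
        then have "inf b p \<le> inf (sup (dia e) (dia (- p))) p" by (rule inf_mono) simp
        \<comment> \<open>Compatibility of \<theta> with the operator enters here: \<not>p is
          congruent to 0, so its image is too.\<close>
        moreover have "inf (dia (- p)) p = bot"
        proof -
          have "(- p, bot) \<in> \<theta>" using principal_cong_iff[OF t p] by simp
          then have "(dia (- p), bot) \<in> \<theta>"
            using fin_congs_dia[OF t] modal_algebra.dia_bot[OF ma] by metis
          then show ?thesis using principal_cong_iff[OF t p] by simp
        qed
        ultimately have "inf b p \<le> dia e" by (simp add: inf_sup_distrib2)
        then show "cong_le \<theta> b c"
          using le_c[OF ex] principal_cong_le_iff[OF t p] order_trans by blast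
      qed
      then show ?thesis by (simp add: le_iff)
    qed
    then have "\<Squnion>\<^bsub>C\<^esub> {m a |a. m a \<sqsubseteq>\<^bsub>C\<^esub> ?u} \<sqsubseteq>\<^bsub>C\<^esub> \<Sqinter>\<^bsub>C\<^esub> {m a |a. ?l \<sqsubseteq>\<^bsub>C\<^esub> m a}"
      by (intro C.sup_least C.inf_greatest C.inf_closed) (auto simp: mc)
    then show ?thesis using join[OF uc] meet[OF lc] by simp
  qed
  ultimately show "?l = ?u" using C.le_antisym lc uc by blast
qed

section \<open>A join-dense embedding makes finite congruences principal\<close>

text \<open>Join-density of \<open>m\<close> is transported back along the isomorphism, in the form
  of a test on embedded elements.\<close>

lemma completion_iso_join_dense:
  assumes iso: "completion_iso k D m C" and M: "macneille_completion m C"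
    and x: "x \<in> carrier D" and y: "y \<in> carrier D"
    and ub: "\<And>a. k a \<sqsubseteq>\<^bsub>D\<^esub> x \<Longrightarrow> k a \<sqsubseteq>\<^bsub>D\<^esub> y"
  shows "x \<sqsubseteq>\<^bsub>D\<^esub> y"
proof -
  obtain g where g: "lattice_iso g D C" "g \<circ> k = m" and k: "completion k D" and m: "completion m C"
    using iso unfolding completion_iso_def by blast
  interpret D: complete_lattice D using k by (simp add: completion_def)
  interpret C: complete_lattice C using m by (simp add: completion_def)
  have kc: "k a \<in> carrier D" for a using k by (auto simp: completion_def)
  have mc: "m a \<in> carrier C" for a using m by (auto simp: completion_def)
  have gc: "g z \<in> carrier C" if "z \<in> carrier D" for z
    using g(1) that unfolding lattice_iso_def bij_betw_def by blast
  \<comment> \<open>\<open>lattice_iso\<close> speaks only of meets and joins; the order is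
    recovered from meets and reflected by injectivity of \<open>g\<close>.\<close>
  have gle: "g z \<sqsubseteq>\<^bsub>C\<^esub> g w \<longleftrightarrow> z \<sqsubseteq>\<^bsub>D\<^esub> w" if zw: "z \<in> carrier D" "w \<in> carrier D" for z w
  proof -
    have "g z \<sqsubseteq>\<^bsub>C\<^esub> g w \<longleftrightarrow> g z = g z \<sqinter>\<^bsub>C\<^esub> g w" using C.le_iff_join[OF gc gc] zw by simp
    also have "\<dots> \<longleftrightarrow> g z = g (z \<sqinter>\<^bsub>D\<^esub> w)" using g(1) zw unfolding lattice_iso_def by simp
    also have "\<dots> \<longleftrightarrow> z = z \<sqinter>\<^bsub>D\<^esub> w"
      using g(1) inj_on_eq_iff[OF _ zw(1) D.meet_closed[OF zw]]
      unfolding lattice_iso_def bij_betw_def by blast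
    also have "\<dots> \<longleftrightarrow> z \<sqsubseteq>\<^bsub>D\<^esub> w" using D.le_iff_join[OF zw] by simp
    finally show ?thesis .
  qed
  have gk: "g (k a) = m a" for a using g(2) by auto
  have "\<Squnion>\<^bsub>C\<^esub> {m a |a. m a \<sqsubseteq>\<^bsub>C\<^esub> g x} \<sqsubseteq>\<^bsub>C\<^esub> g y"
  proof (rule C.sup_least)
    fix z assume "z \<in> {m a |a. m a \<sqsubseteq>\<^bsub>C\<^esub> g x}"
    then obtain a where a: "z = m a" "m a \<sqsubseteq>\<^bsub>C\<^esub> g x" by blast
    then have "k a \<sqsubseteq>\<^bsub>D\<^esub> x" using gle[OF kc x] gk by simp
    then have "g (k a) \<sqsubseteq>\<^bsub>C\<^esub> g y" using gle[OF kc y] ub by simp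
    then show "z \<sqsubseteq>\<^bsub>C\<^esub> g y" using gk a by simp
  qed (auto simp: mc gc y)
  then have "g x \<sqsubseteq>\<^bsub>C\<^esub> g y" using M gc[OF x] unfolding macneille_completion_def by simp
  then show ?thesis using gle[OF x y] by simp
qed

text \<open>Let \<open>v\<close> be the largest element of the profinite completion that vanishes at \<open>\<theta>\<close>, and \<open>w\<close> its
  complement. As \<open>w\<close> is a join of embedded elements and joins are finite at coordinate \<open>\<theta>\<close>,
  a single embedded \<open>a \<le> w\<close> already has value \<open>1\<close> there; this \<open>a\<close> generates \<open>1/\<theta>\<close>.\<close>

lemma principal_of_join_dense:
  assumes inj: "inj (prof_embed dia)"
    and dense: "\<And>x y. x \<in> prof_carrier dia \<Longrightarrow> y \<in> prof_carrier dia \<Longrightarrow>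
      (\<And>a. prof_embed dia a \<sqsubseteq>\<^bsub>profinite_completion dia\<^esub> x \<Longrightarrow>
        prof_embed dia a \<sqsubseteq>\<^bsub>profinite_completion dia\<^esub> y) \<Longrightarrow>
      x \<sqsubseteq>\<^bsub>profinite_completion dia\<^esub> y"
    and t: "\<theta> \<in> fin_congs dia"
  shows "\<exists>a. \<theta> `` {top} = {b. b \<ge> a}"
proof -
  let ?P = "profinite_completion dia" and ?m = "prof_embed dia"
  have emb: "a \<in> ?m a \<psi>" if "\<psi> \<in> fin_congs dia" for a \<psi>
    using that fin_congs_refl prof_embed_mem_iff by blast
  define Z where "Z = {\<alpha>\<in>prof_carrier dia. bot \<in> \<alpha> \<theta>}"
  have "Z \<subseteq> prof_carrier dia" by (auto simp: Z_def)
  obtain v where v: "least ?P v (Upper ?P Z)"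
    and vj: "\<forall>\<psi>\<in>fin_congs dia.
      \<exists>D. finite D \<and> D \<subseteq> (\<Union>\<alpha>\<in>Z. \<alpha> \<psi>) \<and> Sup_fin (insert bot D) \<in> v \<psi>"
    using prof_join_exists[OF \<open>Z \<subseteq> prof_carrier dia\<close>] .
  have vc: "v \<in> prof_carrier dia" using v by (auto simp: least_def Upper_def)
  have v_ub: "\<alpha> \<sqsubseteq>\<^bsub>?P\<^esub> v" if "\<alpha> \<in> prof_carrier dia" "bot \<in> \<alpha> \<theta>" for \<alpha>
    using v that unfolding least_def Upper_def Z_def by auto
  \<comment> \<open>The supremum \<open>v\<close> still vanishes at \<theta> because its coordinate
    there is a finite join of elements congruent to 0.\<close>
  have v_bot: "bot \<in> v \<theta>"
  proof -
    obtain D where D: "finite D" "D \<subseteq> (\<Union>\<alpha>\<in>Z. \<alpha> \<theta>)" "Sup_fin (insert bot D) \<in> v \<theta>"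
      using vj t by blast
    have "cong_le \<theta> d bot" if d: "d \<in> D" for d
    proof -
      obtain \<alpha> where "\<alpha> \<in> prof_carrier dia" "bot \<in> \<alpha> \<theta>" "d \<in> \<alpha> \<theta>" using D(2) d unfolding Z_def by blast
      then have "(bot, d) \<in> \<theta>" using prof_class_rel[OF _ t] by metis
      then show ?thesis by (simp add: cong_le_def)
    qed
    then have "cong_le \<theta> (Sup_fin (insert bot D)) bot" by (rule cong_le_Sup_fin[OF t D(1)])
    then have "(Sup_fin (insert bot D), bot) \<in> \<theta>"
      by (rule cong_le_antisym[OF t]) (simp add: cong_le_of_le[OF t])
    then show ?thesis using prof_class_rel[OF vc t D(3)] by simp
  qed
  \<comment> \<open>Since \<open>prof_op\<close> takes a binary operation, complement is passed as
    one that ignores its second argument.\<close>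
  define w where "w = prof_op dia (\<lambda>a b. - a) v v"
  have compl: "quot_op (\<lambda>a b. - a) \<psi> (\<psi> `` {a}) (\<psi> `` {b}) = \<psi> `` {- a}"
    if "\<psi> \<in> fin_congs dia" for \<psi> a b
    by (rule quot_op_class[OF fin_congs_equiv[OF that]]) (rule fin_congs_compl[OF that])
  have wc: "w \<in> prof_carrier dia" unfolding w_def by (rule prof_op_closed[OF vc vc compl])
  have w_mem: "- a \<in> w \<psi>" if s: "\<psi> \<in> fin_congs dia" and a: "a \<in> v \<psi>" for a \<psi>
  proof -
    have "v \<psi> = \<psi> `` {a}" using prof_class_iff[OF vc s] a by simp
    then have "w \<psi> = \<psi> `` {- a}" using compl[OF s] s by (simp add: w_def prof_op_def)
    then show ?thesis using fin_congs_refl[OF s] by simp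
  qed
  have w_top: "top \<in> w \<theta>" using w_mem[OF t v_bot] by simp
  define E where "E = {?m a |a. ?m a \<sqsubseteq>\<^bsub>?P\<^esub> w}"
  have "E \<subseteq> prof_carrier dia" using prof_embed_carrier by (auto simp: E_def)
  obtain s where s: "least ?P s (Upper ?P E)"
    and sj: "\<forall>\<psi>\<in>fin_congs dia.
      \<exists>D. finite D \<and> D \<subseteq> (\<Union>\<alpha>\<in>E. \<alpha> \<psi>) \<and> Sup_fin (insert bot D) \<in> s \<psi>"
    using prof_join_exists[OF \<open>E \<subseteq> prof_carrier dia\<close>] .
  have sc: "s \<in> prof_carrier dia" using s by (auto simp: least_def Upper_def)
  \<comment> \<open>Density makes \<open>w\<close> lie below the join \<open>s\<close> of the
    embedded elements under it.\<close>
  have "w \<sqsubseteq>\<^bsub>?P\<^esub> s"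
    by (rule dense[OF wc sc]) (use s prof_embed_carrier in \<open>auto simp: least_def Upper_def E_def\<close>)
  obtain D where D: "finite D" "D \<subseteq> (\<Union>\<alpha>\<in>E. \<alpha> \<theta>)" "Sup_fin (insert bot D) \<in> s \<theta>"
    using sj t by blast
  \<comment> \<open>Embedded elements below \<open>w\<close> are closed under finite joins, so the
    finite join at \<theta> is represented by a single one of them.\<close>
  have "\<exists>a. ?m a \<sqsubseteq>\<^bsub>?P\<^esub> w \<and> (a, Sup_fin (insert bot D)) \<in> \<theta>"
    using D(1,2)
  proof (induction D rule: finite_induct)
    case empty
    have "?m bot \<sqsubseteq>\<^bsub>?P\<^esub> w"
    proof (rule prof_leI[OF prof_embed_carrier wc])
      fix \<psi> assume s: "\<psi> \<in> fin_congs dia"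
      obtain b where "b \<in> w \<psi>" using prof_class_nonempty[OF wc s] .
      then show "\<exists>a\<in>?m bot \<psi>. \<exists>b\<in>w \<psi>. cong_le \<psi> a b"
        using emb[OF s] cong_le_of_le[OF s bot_least] by blast
    qed
    then show ?case using fin_congs_refl[OF t] by auto
  next
    case (insert d D)
    obtain a where a: "?m a \<sqsubseteq>\<^bsub>?P\<^esub> w" "(a, Sup_fin (insert bot D)) \<in> \<theta>" using insert by blast
    obtain c where c: "?m c \<sqsubseteq>\<^bsub>?P\<^esub> w" "(c, d) \<in> \<theta>"
      using insert.prems prof_embed_mem_iff[OF t] by (auto simp: E_def)
    have "?m (sup c a) \<sqsubseteq>\<^bsub>?P\<^esub> w"
    proof (rule prof_leI[OF prof_embed_carrier wc])
      fix \<psi> assume s: "\<psi> \<in> fin_congs dia"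
      obtain b where b: "b \<in> w \<psi>" using prof_class_nonempty[OF wc s] .
      have "cong_le \<psi> c b" by (rule prof_leD[OF c(1) prof_embed_carrier wc s emb[OF s] b])
      moreover have "cong_le \<psi> a b" by (rule prof_leD[OF a(1) prof_embed_carrier wc s emb[OF s] b])
      ultimately have "cong_le \<psi> (sup c a) b" by (rule cong_le_sup[OF s])
      then show "\<exists>a\<in>?m (sup c a) \<psi>. \<exists>b\<in>w \<psi>. cong_le \<psi> a b" using emb[OF s] b by blast
    qed
    moreover have "Sup_fin (insert bot (insert d D)) = sup d (Sup_fin (insert bot D))"
      using insert.hyps by (subst insert_commute) simp
    ultimately show ?case using fin_congs_sup[OF t c(2) a(2)] by metis
  qed
  then obtain a where a: "?m a \<sqsubseteq>\<^bsub>?P\<^esub> w" "(a, Sup_fin (insert bot D)) \<in> \<theta>" by blast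
  \<comment> \<open>At \<theta>, \<open>w\<close> has value 1 and lies below \<open>s\<close>, so
    the finite join represented by \<open>a\<close> is congruent to 1.\<close>
  have a_top: "(top, a) \<in> \<theta>"
  proof -
    have "cong_le \<theta> top (Sup_fin (insert bot D))"
      by (rule prof_leD[OF \<open>w \<sqsubseteq>\<^bsub>?P\<^esub> s\<close> wc sc t w_top D(3)])
    then have "(Sup_fin (insert bot D), top) \<in> \<theta>" by (simp add: cong_le_def)
    then show ?thesis using a(2) fin_congs_sym[OF t] fin_congs_trans[OF t] by blast
  qed
  have "\<theta> `` {top} = {b. b \<ge> a}"
  proof (intro equalityI subsetI)
    fix b assume "b \<in> \<theta> `` {top}"
    then have "(- b, bot) \<in> \<theta>" using fin_congs_compl[OF t] fin_congs_sym[OF t] by fastforce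
    then have "?m (- b) \<sqsubseteq>\<^bsub>?P\<^esub> v"
      using v_ub[OF prof_embed_carrier] prof_embed_mem_iff[OF t] by blast
    \<comment> \<open>The images of \<open>a\<close> and \<not>b lie below the complementary
      elements \<open>w\<close> and \<open>v\<close>, so their meet vanishes at every coordinate.
      Injectivity then gives a \<le> b.\<close>
    have "?m (inf a (- b)) = ?m bot"
    proof (rule prof_eqI[OF prof_embed_carrier prof_embed_carrier])
      fix \<psi> assume s: "\<psi> \<in> fin_congs dia"
      obtain c where c: "c \<in> v \<psi>" using prof_class_nonempty[OF vc s] .
      have "cong_le \<psi> a (- c)"
        by (rule prof_leD[OF a(1) prof_embed_carrier wc s emb[OF s] w_mem[OF s c]])
      moreover have "cong_le \<psi> (- b) c"
        by (rule prof_leD[OF \<open>?m (- b) \<sqsubseteq>\<^bsub>?P\<^esub> v\<close> prof_embed_carrier vc s emb[OF s] c])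
      ultimately have "(inf (inf a (- c)) (inf (- b) c), inf a (- b)) \<in> \<psi>"
        unfolding cong_le_def by (rule fin_congs_inf[OF s])
      moreover have "inf (inf a (- c)) (inf (- b) c) = bot"
        by (simp add: inf.assoc inf.left_commute[of "- c"])
      ultimately have "(inf a (- b), bot) \<in> \<psi>" using fin_congs_sym[OF s] by simp
      then show "?m (inf a (- b)) \<psi> = ?m bot \<psi>"
        using s fin_congs_class_eq_iff[OF s] by (simp add: prof_embed_def)
    qed
    then have "inf a (- b) = bot" using inj by (simp add: inj_eq)
    then show "b \<in> {b. b \<ge> a}" by (simp add: inf_shunt)
  next
    fix b assume "b \<in> {b. b \<ge> a}"
    then have "sup a b = b" by (simp add: sup.absorb2)
    then show "b \<in> \<theta> `` {top}"
      using fin_congs_sup[OF t a_top fin_congs_refl[OF t, of b]] by simp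
  qed
  then show ?thesis by blast
qed

text \<open>The MacNeille completion is an arbitrary pair \<open>m\<close>, \<open>C\<close>: one
  exists by \<open>macneille_completion_cuts\<close>, and \<open>macneille_completion_unique\<close>
  makes any two isomorphic. That uniqueness also turns density of \<open>prof_embed\<close> into the
  isomorphism of the first condition.\<close>

theorem theorem3p1:
  fixes dia :: "'a::boolean_algebra \<Rightarrow> 'a"
    and m :: "'a \<Rightarrow> 'c" and C :: "'c gorder"
  assumes "modal_algebra dia"
    and "macneille_completion m C"
  shows "(completion_iso (prof_embed dia) (profinite_completion dia) m C \<and> smooth m C dia)
    \<longleftrightarrow> (residually_finite dia \<and>
         (\<forall>\<theta>\<in>fin_congs dia. \<exists>a. \<theta> `` {top} = {b. b \<ge> a}))"
proof (intro iffI conjI ballI; elim conjE)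
  assume iso: "completion_iso (prof_embed dia) (profinite_completion dia) m C"
  then have inj: "inj (prof_embed dia)" by (simp add: completion_iso_def completion_def)
  show "residually_finite dia"
    unfolding residually_finite_def
  proof (intro allI impI, rule ccontr)
    fix a b :: 'a assume "a \<noteq> b" and "\<not> (\<exists>\<theta>\<in>fin_congs dia. \<theta> `` {a} \<noteq> \<theta> `` {b})"
    then have "prof_embed dia a = prof_embed dia b"
      unfolding prof_embed_def by (intro restrict_ext) blast
    then show False using inj \<open>a \<noteq> b\<close> by (simp add: inj_eq)
  qed
  show "\<exists>a. \<theta> `` {top} = {b. b \<ge> a}" if "\<theta> \<in> fin_congs dia" for \<theta>
    using principal_of_join_dense[OF inj _ that] completion_iso_join_dense[OF iso assms(2)]
    by simp
next
  assume "residually_finite dia" "\<forall>\<theta>\<in>fin_congs dia. \<exists>a. \<theta> `` {top} = {b. b \<ge> a}"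
  then show "completion_iso (prof_embed dia) (profinite_completion dia) m C" "smooth m C dia"
    using macneille_completion_unique[OF prof_macneille_completion assms(2)]
      smooth_of_principal[OF assms] by blast+
qed

end
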